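(* Let $0\le l\le n$. (1) Let $\widetilde U_{l+1},\dots,\widetilde U_n$ be unitaries on a Hilbert space $W$ with $\widetilde U_i^*\widetilde U_j=\overline{z_{ij}}\widetilde U_j\widetilde U_i^*$ for $i\ne j$ in $\{l+1,\dots,n\}$. Then the standard $n$-tuple $(S_1,\dots,S_l,U_{l+1},\dots,U_n)$ with $\{1,\dots,l\}$-wandering data $(\mathbf 1_W,\widetilde U_{l+1},\dots,\widetilde U_n)$ is an $n$-tuple of doubly non-commuting isometries on $\ell^2(\mathbb N_0^l)\otimes W$; its $\{1,\dots,l\}$-wandering subspace is $e_{0,\dots,0}\otimes W$, which under the canonical identification with $W$ gives $\{1,\dots,l\}$-wandering data $(\mathbf 1_W,\widetilde U_{l+1},\dots,\widetilde U_n)$; all other $A$-wandering data ($A\ne\{1,\dots,l\}$) are tuples of operators on the zero space; $S_1,\dots,S_l$ are pure isometries and $U_{l+1},\dots,U_n$ are unitary. (2) If $(V_1,\dots,V_n)$ is an $n$-tuple of doubly non-commuting isometries with $V_1,\dots,V_l$ pure isometries and $V_{l+1},\dots,V_n$ unitary, $W$ is its $\{1,\dots,l\}$-wandering subspace and $\widetilde U_i=V_i|_W$ for $i=l+1,\dots,n$, then $(V_1,\dots,V_n)$ is unitarily equivalent to the standard $n$-tuple with $\{1,\dots,l\}$-wandering data $(\mathbf 1_W,\widetilde U_{l+1},\dots,\widetilde U_n)$. (Lists whose lower index exceeds the upper index are empty.)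
   Context: Fix $n\ge1$ and $z_{ij}\in\mathbb T$ ($i\ne j$) with $z_{ji}=\overline{z_{ij}}$; $(V_1,\dots,V_n)$ is doubly non-commuting if the $V_i$ are isometries with $V_i^*V_j=\overline{z_{ij}}V_jV_i^*$ for $i\ne j$. A pure isometry $S$ on $H$: $\{0\}$ is the only $S$-invariant subspace on which $S$ is unitary. Standard $n$-tuple with $\{1,\dots,l\}$-wandering data $(\mathbf 1_W,\widetilde U_{l+1},\dots,\widetilde U_n)$: on $\ell^2(\mathbb N_0^l)\otimes W$ with orthonormal basis $e_{k_1,\dots,k_l}$ (for $l=0$ the space is $W$), $S_i(e_{k_1,\dots,k_l}\otimes x)=z_{i,1}^{k_1}\cdots z_{i,i-1}^{k_{i-1}}e_{k_1,\dots,k_i+1,\dots,k_l}\otimes x$ for $i\le l$, and $U_i(e_{k_1,\dots,k_l}\otimes x)=z_{i,1}^{k_1}\cdots z_{i,l}^{k_l}e_{k_1,\dots,k_l}\otimes\widetilde U_ix$ for $i>l$. For $A\subseteq\{1,\dots,n\}$ with $A^c=\{j_1<\dots<j_m\}$, the $A$-wandering subspace of a tuple is $W_A=\bigcap_{(m_j)\in\mathbb N_0^{A^c}}\big(\prod_{j\in A^c}V_j^{m_j}\big)\big(\bigcap_{i\in A}\ker V_i^*\big)$ (empty intersection of kernels $=$ whole space), and the $A$-wandering data are $(\mathbf 1_{W_A},V_{j_1}|_{W_A},\dots,V_{j_m}|_{W_A})$. Unitary equivalence: a single unitary intertwining all corresponding operators. *)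

theory Defs
  imports "HOL-Analysis.Analysis" "HOL-Library.Function_Algebras"
begin

class complex_vector = ab_group_add +
  fixes scaleC :: "complex \<Rightarrow> 'a \<Rightarrow> 'a" (infixr \<open>*\<^sub>C\<close> 75)
  assumes scaleC_add_right: "a *\<^sub>C (x + y) = a *\<^sub>C x + a *\<^sub>C y"
    and scaleC_add_left: "(a + b) *\<^sub>C x = a *\<^sub>C x + b *\<^sub>C x"
    and scaleC_scaleC: "a *\<^sub>C (b *\<^sub>C x) = (a * b) *\<^sub>C x"
    and scaleC_one: "1 *\<^sub>C x = x"

instantiation "fun" :: (type, complex_vector) complex_vector
begin
definition scaleC_fun :: "complex \<Rightarrow> ('a \<Rightarrow> 'b) \<Rightarrow> 'a \<Rightarrow> 'b"
  where "scaleC_fun c f = (\<lambda>x. c *\<^sub>C f x)"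
instance
  by standard (simp_all add: scaleC_fun_def fun_eq_iff scaleC_add_right scaleC_add_left
      scaleC_scaleC scaleC_one)
end

definition hnorm :: "('a \<Rightarrow> 'a \<Rightarrow> complex) \<Rightarrow> 'a \<Rightarrow> real" where
  "hnorm ip x = sqrt (Re (ip x x))"

definition csubspace :: "'a::complex_vector set \<Rightarrow> bool" where
  "csubspace M \<longleftrightarrow> 0 \<in> M \<and> (\<forall>x\<in>M. \<forall>y\<in>M. x + y \<in> M) \<and> (\<forall>c. \<forall>x\<in>M. c *\<^sub>C x \<in> M)"

definition hilbert_space :: "'a::complex_vector set \<Rightarrow> ('a \<Rightarrow> 'a \<Rightarrow> complex) \<Rightarrow> bool" where
  "hilbert_space H ip \<longleftrightarrow>
     csubspace H \<and>
     (\<forall>x\<in>H. \<forall>y\<in>H. \<forall>w\<in>H. ip (x + y) w = ip x w + ip y w) \<and>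
     (\<forall>c. \<forall>x\<in>H. \<forall>y\<in>H. ip (c *\<^sub>C x) y = c * ip x y) \<and>
     (\<forall>x\<in>H. \<forall>y\<in>H. ip x y = cnj (ip y x)) \<and>
     (\<forall>x\<in>H. Im (ip x x) = 0 \<and> Re (ip x x) \<ge> 0) \<and>
     (\<forall>x\<in>H. ip x x = 0 \<longrightarrow> x = 0) \<and>
     (\<forall>s. (\<forall>k. s k \<in> H) \<longrightarrow>
          (\<forall>e>0. \<exists>N. \<forall>m\<ge>N. \<forall>k\<ge>N. hnorm ip (s m - s k) < e) \<longrightarrow>
          (\<exists>x\<in>H. (\<lambda>k. hnorm ip (s k - x)) \<longlonglongrightarrow> 0))"

definition closed_csubspace :: "'a::complex_vector set \<Rightarrow> ('a \<Rightarrow> 'a \<Rightarrow> complex) \<Rightarrow> 'a set \<Rightarrow> bool" where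
  "closed_csubspace H ip M \<longleftrightarrow> M \<subseteq> H \<and> csubspace M \<and>
     (\<forall>s x. (\<forall>k. s k \<in> M) \<longrightarrow> x \<in> H \<longrightarrow> (\<lambda>k. hnorm ip (s k - x)) \<longlonglongrightarrow> 0 \<longrightarrow> x \<in> M)"

definition clinear_on :: "'a::complex_vector set \<Rightarrow> ('a \<Rightarrow> 'b::complex_vector) \<Rightarrow> bool" where
  "clinear_on H T \<longleftrightarrow> (\<forall>x\<in>H. \<forall>y\<in>H. T (x + y) = T x + T y) \<and> (\<forall>c. \<forall>x\<in>H. T (c *\<^sub>C x) = c *\<^sub>C T x)"

definition isometry_on :: "'a::complex_vector set \<Rightarrow> ('a \<Rightarrow> 'a \<Rightarrow> complex) \<Rightarrow> ('a \<Rightarrow> 'a) \<Rightarrow> bool" where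
  "isometry_on H ip V \<longleftrightarrow> V ` H \<subseteq> H \<and> clinear_on H V \<and> (\<forall>x\<in>H. \<forall>y\<in>H. ip (V x) (V y) = ip x y)"

definition unitary_on :: "'a::complex_vector set \<Rightarrow> ('a \<Rightarrow> 'a \<Rightarrow> complex) \<Rightarrow> ('a \<Rightarrow> 'a) \<Rightarrow> bool" where
  "unitary_on H ip U \<longleftrightarrow> isometry_on H ip U \<and> U ` H = H"

text \<open>Hilbert space adjoint (meaningful on H only).\<close>
definition adj :: "'a set \<Rightarrow> ('a \<Rightarrow> 'a \<Rightarrow> complex) \<Rightarrow> ('a \<Rightarrow> 'a) \<Rightarrow> ('a \<Rightarrow> 'a)" where
  "adj H ip T = (SOME T'. T' ` H \<subseteq> H \<and> (\<forall>x\<in>H. \<forall>y\<in>H. ip (T x) y = ip x (T' y)))"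

definition pure_isometry :: "'a::complex_vector set \<Rightarrow> ('a \<Rightarrow> 'a \<Rightarrow> complex) \<Rightarrow> ('a \<Rightarrow> 'a) \<Rightarrow> bool" where
  "pure_isometry H ip S \<longleftrightarrow> isometry_on H ip S \<and>
     (\<forall>M. closed_csubspace H ip M \<longrightarrow> S ` M \<subseteq> M \<longrightarrow> unitary_on M ip S \<longrightarrow> M = {0})"

definition dnc :: "nat \<Rightarrow> (nat \<Rightarrow> nat \<Rightarrow> complex) \<Rightarrow> 'a::complex_vector set \<Rightarrow> ('a \<Rightarrow> 'a \<Rightarrow> complex)
                     \<Rightarrow> (nat \<Rightarrow> 'a \<Rightarrow> 'a) \<Rightarrow> bool" where
  "dnc n z H ip V \<longleftrightarrow> (\<forall>i\<in>{1..n}. isometry_on H ip (V i)) \<and>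
     (\<forall>i\<in>{1..n}. \<forall>j\<in>{1..n}. i \<noteq> j \<longrightarrow>
        (\<forall>x\<in>H. adj H ip (V i) (V j x) = cnj (z i j) *\<^sub>C V j (adj H ip (V i) x)))"

fun prod_ops :: "(nat \<Rightarrow> 'a \<Rightarrow> 'a) \<Rightarrow> nat list \<Rightarrow> (nat \<Rightarrow> nat) \<Rightarrow> 'a \<Rightarrow> 'a" where
  "prod_ops V [] m = id"
| "prod_ops V (j # js) m = (V j ^^ m j) \<circ> prod_ops V js m"

text \<open>A-wandering subspace; the intersection over (m_j) in N_0^(A^c) is expressed by
  quantifying over all m :: nat => nat (only the values on A^c matter).\<close>
definition wandering :: "nat \<Rightarrow> 'a::complex_vector set \<Rightarrow> ('a \<Rightarrow> 'a \<Rightarrow> complex) \<Rightarrow> (nat \<Rightarrow> 'a \<Rightarrow> 'a)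
                            \<Rightarrow> nat set \<Rightarrow> 'a set" where
  "wandering n H ip V A =
     (let K = {x\<in>H. \<forall>i\<in>A. adj H ip (V i) x = 0};
          js = sorted_list_of_set ({1..n} - A)
      in {x. \<forall>m :: nat \<Rightarrow> nat. x \<in> prod_ops V js m ` K})"

text \<open>Multi-indices (k_1,...,k_l) in N_0^l are functions nat => nat vanishing outside {1..l}.
  An element of l2(N_0^l) (x) W is identified with its coefficient function
  k \<mapsto> (coefficient of e_k) \<in> W, so that e_k (x) x is the function that is x at k and 0 elsewhere.\<close>
definition idx :: "nat \<Rightarrow> (nat \<Rightarrow> nat) set" where
  "idx l = {k. \<forall>i. i \<notin> {1..l} \<longrightarrow> k i = 0}"

definition l2tensor :: "nat \<Rightarrow> 'w::complex_vector set \<Rightarrow> ('w \<Rightarrow> 'w \<Rightarrow> complex) \<Rightarrow> ((nat \<Rightarrow> nat) \<Rightarrow> 'w) set" where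
  "l2tensor l W ipW = {f. (\<forall>k. f k \<in> W) \<and> (\<forall>k. k \<notin> idx l \<longrightarrow> f k = 0) \<and>
                         (\<lambda>k. (hnorm ipW (f k))\<^sup>2) summable_on idx l}"

definition l2ip :: "nat \<Rightarrow> ('w \<Rightarrow> 'w \<Rightarrow> complex) \<Rightarrow> ((nat \<Rightarrow> nat) \<Rightarrow> 'w) \<Rightarrow> ((nat \<Rightarrow> nat) \<Rightarrow> 'w) \<Rightarrow> complex" where
  "l2ip l ipW f g = (\<Sum>\<^sub>\<infinity>k\<in>idx l. ipW (f k) (g k))"

definition basis_tensor :: "(nat \<Rightarrow> nat) \<Rightarrow> 'w::complex_vector \<Rightarrow> (nat \<Rightarrow> nat) \<Rightarrow> 'w" where
  "basis_tensor k x = (\<lambda>k'. if k' = k then x else 0)"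

text \<open>S_i (e_k (x) x) = z_{i,1}^{k_1} ... z_{i,i-1}^{k_{i-1}} e_{k + delta_i} (x) x  (i \<le> l),
  U_i (e_k (x) x) = z_{i,1}^{k_1} ... z_{i,l}^{k_l} e_k (x) Ut_i x  (i > l),
  written out on coefficient functions.\<close>
definition std_op :: "(nat \<Rightarrow> nat \<Rightarrow> complex) \<Rightarrow> nat \<Rightarrow> (nat \<Rightarrow> 'w \<Rightarrow> 'w) \<Rightarrow> nat
                        \<Rightarrow> ((nat \<Rightarrow> nat) \<Rightarrow> 'w::complex_vector) \<Rightarrow> (nat \<Rightarrow> nat) \<Rightarrow> 'w" where
  "std_op z l Ut i f =
     (if i \<le> l then
        (\<lambda>k. if k \<in> idx l \<and> 1 \<le> k i
             then (\<Prod>j\<in>{1..<i}. z i j ^ k j) *\<^sub>C f (k(i := k i - 1))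
             else 0)
      else
        (\<lambda>k. if k \<in> idx l then (\<Prod>j\<in>{1..l}. z i j ^ k j) *\<^sub>C Ut i (f k) else 0))"

definition unitarily_equivalent ::
  "nat \<Rightarrow> 'a::complex_vector set \<Rightarrow> ('a \<Rightarrow> 'a \<Rightarrow> complex) \<Rightarrow> (nat \<Rightarrow> 'a \<Rightarrow> 'a)
   \<Rightarrow> 'b::complex_vector set \<Rightarrow> ('b \<Rightarrow> 'b \<Rightarrow> complex) \<Rightarrow> (nat \<Rightarrow> 'b \<Rightarrow> 'b) \<Rightarrow> bool" where
  "unitarily_equivalent n H ip V H' ip' V' \<longleftrightarrow>
     (\<exists>\<Phi>. \<Phi> ` H = H' \<and> clinear_on H \<Phi> \<and> (\<forall>x\<in>H. \<forall>y\<in>H. ip' (\<Phi> x) (\<Phi> y) = ip x y) \<and>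
          (\<forall>i\<in>{1..n}. \<forall>x\<in>H. \<Phi> (V i x) = V' i (\<Phi> x)))"

end

theory Submission
  imports Defs
begin

text \<open>
  For (1), the adjoints of the standard operators are explicit weighted backward shifts or diagonal
  operators, so every relation reduces to an identity between phase factors; elements in the range
  of all powers of a forward shift vanish identically.

  For (2), let \<open>P\<^sub>i = 1 - V\<^sub>i V\<^sub>i\<^sup>*\<close>. The candidate unitary sends \<open>x\<close> to the family
  \<open>P\<^sub>l (V\<^sub>l\<^sup>*)^k\<^sub>l \<dots> P\<^sub>1 (V\<^sub>1\<^sup>*)^k\<^sub>1 x\<close>, indexed by \<open>k\<close>. For one pure isometry,
  \<open>\<parallel>x\<parallel>\<^sup>2\<close> is the sum of the \<open>\<parallel>P (V\<^sup>*)^k x\<parallel>\<^sup>2\<close> by telescoping, since \<open>(V\<^sup>*)^k x\<close> tends to 0;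
  iterating this over the coordinates makes the map isometric. The commutation relations give the
  intertwining property and place the values in the wandering subspace. The range is complete and
  contains every elementary tensor, hence is everything.
\<close>

section \<open>Inner product spaces on a carrier\<close>

text \<open>The adjoint \<open>adj\<close> is a choice by \<open>SOME\<close>, so nothing can be
  said about it before an adjoint is exhibited. For an isometry of a complete space one comes from
  projecting onto the range, which is complete because distances are preserved. For the standard
  tuple an explicit formula is tested against all vectors, so the sequence space enters only as an
  inner product space. In part (2) completeness is drawn from \<open>H\<close> and carried over to
  the range of the candidate unitary.

  The phases of the standard tuple are dictated by the order in which coordinates are stripped off,
  the first one first: \<open>V_i\<close> must pass the powers of the adjoints of
  \<open>V_1\<close>, ..., \<open>V_{i-1}\<close>, gaining one factor \<open>z i j\<close> per
  passage, before it meets its own adjoint; the coordinates above \<open>i\<close> never see it. The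
  projections \<open>P_j\<close> add no phase, since the two phases met on crossing
  \<open>V_j\<close> and its adjoint are inverse to each other. This rests on the relation
  \<open>V_i V_j = z i j V_j V_i\<close>, which the hypotheses do not list; it is forced by the
  equality case of Cauchy-Schwarz.\<close>

lemma scaleC_zero_right [simp]: "a *\<^sub>C (0::'a::complex_vector) = 0"
  using scaleC_add_right[of a 0 0] by simp

lemma scaleC_zero_left [simp]: "0 *\<^sub>C (x::'a::complex_vector) = 0"
  using scaleC_add_left[of 0 0 x] by simp

lemma scaleC_minus_one: "(- 1) *\<^sub>C (x::'a::complex_vector) = - x"
  using scaleC_add_left[of 1 "- 1" x] by (simp add: scaleC_one add_eq_0_iff)

lemma scaleC_minus_right: "a *\<^sub>C (- x) = - (a *\<^sub>C (x::'a::complex_vector))"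
  by (metis mult.commute scaleC_minus_one scaleC_scaleC)

lemma scaleC_diff_right: "a *\<^sub>C (x - y) = a *\<^sub>C x - a *\<^sub>C (y::'a::complex_vector)"
  using scaleC_add_right[of a x "- y"] by (simp add: scaleC_minus_right)

lemma scaleC_fun_apply [simp]: "(c *\<^sub>C f) x = c *\<^sub>C f x"
  by (simp add: scaleC_fun_def)

lemma scaleC_cancel:
  fixes x :: "'a::complex_vector"
  assumes "c \<noteq> 0" "c *\<^sub>C x = c *\<^sub>C y" shows "x = y"
proof -
  have "inverse c *\<^sub>C c *\<^sub>C x = inverse c *\<^sub>C c *\<^sub>C y" using assms(2) by simp
  then show ?thesis using assms(1) by (simp add: scaleC_scaleC scaleC_one)
qed

text \<open>Estimates use squared norms because they expand algebraically. The triangle inequality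
  then carries factors 2, which are harmless for limits.\<close>

definition sqnorm :: "('a \<Rightarrow> 'a \<Rightarrow> complex) \<Rightarrow> 'a \<Rightarrow> real" where
  "sqnorm ip x = Re (ip x x)"

text \<open>Completeness is split off into \<open>hilbert\<close> so that the same calculus applies
  to \<open>l2tensor\<close>, for which only the inner product axioms are verified.\<close>

locale inner_space =
  fixes H :: "'a::complex_vector set" and ip :: "'a \<Rightarrow> 'a \<Rightarrow> complex"
  assumes csubspace_carrier: "csubspace H"
    and ip_add_left: "\<lbrakk>x \<in> H; y \<in> H; w \<in> H\<rbrakk> \<Longrightarrow> ip (x + y) w = ip x w + ip y w"
    and ip_scale_left: "\<lbrakk>x \<in> H; y \<in> H\<rbrakk> \<Longrightarrow> ip (c *\<^sub>C x) y = c * ip x y"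
    and ip_commute: "\<lbrakk>x \<in> H; y \<in> H\<rbrakk> \<Longrightarrow> ip x y = cnj (ip y x)"
    and sqnorm_nonneg: "x \<in> H \<Longrightarrow> 0 \<le> sqnorm ip x"
    and ip_definite: "\<lbrakk>x \<in> H; ip x x = 0\<rbrakk> \<Longrightarrow> x = 0"
begin

lemma zero_in [simp]: "0 \<in> H"
  and add_in [simp]: "x \<in> H \<Longrightarrow> y \<in> H \<Longrightarrow> x + y \<in> H"
  and scaleC_in [simp]: "x \<in> H \<Longrightarrow> c *\<^sub>C x \<in> H"
  using csubspace_carrier by (auto simp: csubspace_def)

lemma uminus_in [simp]: "x \<in> H \<Longrightarrow> - x \<in> H"
  using scaleC_in[of x "- 1"] by (simp add: scaleC_minus_one)

lemma diff_in [simp]: "x \<in> H \<Longrightarrow> y \<in> H \<Longrightarrow> x - y \<in> H"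
  using add_in[of x "- y"] by simp

lemma ip_add_right: "\<lbrakk>x \<in> H; y \<in> H; w \<in> H\<rbrakk> \<Longrightarrow> ip w (x + y) = ip w x + ip w y"
  by (metis add_in complex_cnj_add ip_add_left ip_commute)

lemma ip_scale_right: "\<lbrakk>x \<in> H; y \<in> H\<rbrakk> \<Longrightarrow> ip x (c *\<^sub>C y) = cnj c * ip x y"
  by (metis complex_cnj_mult ip_commute ip_scale_left scaleC_in)

lemma ip_minus_left: "\<lbrakk>x \<in> H; y \<in> H\<rbrakk> \<Longrightarrow> ip (- x) y = - ip x y"
  using ip_scale_left[of x y "- 1"] by (simp add: scaleC_minus_one)

lemma ip_minus_right: "\<lbrakk>x \<in> H; y \<in> H\<rbrakk> \<Longrightarrow> ip x (- y) = - ip x y"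
  using ip_scale_right[of x y "- 1"] by (simp add: scaleC_minus_one)

lemma ip_diff_left: "\<lbrakk>x \<in> H; y \<in> H; w \<in> H\<rbrakk> \<Longrightarrow> ip (x - y) w = ip x w - ip y w"
  using ip_add_left[of x "- y" w] by (simp add: ip_minus_left)

lemma ip_diff_right: "\<lbrakk>x \<in> H; y \<in> H; w \<in> H\<rbrakk> \<Longrightarrow> ip w (x - y) = ip w x - ip w y"
  using ip_add_right[of x "- y" w] by (simp add: ip_minus_right)

lemma ip_zero_left [simp]: "x \<in> H \<Longrightarrow> ip 0 x = 0"
  using ip_scale_left[of 0 x 0] by simp

lemma ip_zero_right [simp]: "x \<in> H \<Longrightarrow> ip x 0 = 0"
  using ip_scale_right[of x 0 0] by simp

lemmas ip_linear = ip_add_left ip_add_right ip_scale_left ip_scale_right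
  ip_minus_left ip_minus_right ip_diff_left ip_diff_right

lemma ip_self: "x \<in> H \<Longrightarrow> ip x x = of_real (sqnorm ip x)"
  using arg_cong[OF ip_commute[of x x], of Im] by (simp add: sqnorm_def complex_eq_iff)

lemma sqnorm_zero [simp]: "sqnorm ip 0 = 0"
  by (simp add: sqnorm_def)

lemma sqnorm_eq_0_iff: "x \<in> H \<Longrightarrow> sqnorm ip x = 0 \<longleftrightarrow> x = 0"
  using ip_definite ip_self by force

lemma sqnorm_scale: "x \<in> H \<Longrightarrow> sqnorm ip (c *\<^sub>C x) = (cmod c)\<^sup>2 * sqnorm ip x"
proof -
  assume "x \<in> H"
  then have "ip (c *\<^sub>C x) (c *\<^sub>C x) = of_real ((cmod c)\<^sup>2 * sqnorm ip x)"
    using ip_self[of x] by (simp add: ip_linear complex_norm_square del: of_real_power)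
  then show ?thesis by (simp add: sqnorm_def)
qed

lemma sqnorm_minus: "x \<in> H \<Longrightarrow> sqnorm ip (- x) = sqnorm ip x"
  by (simp add: sqnorm_def ip_linear)

lemma sqnorm_diff_commute: "\<lbrakk>x \<in> H; y \<in> H\<rbrakk> \<Longrightarrow> sqnorm ip (x - y) = sqnorm ip (y - x)"
  by (metis diff_in minus_diff_eq sqnorm_minus)

lemma sqnorm_add: "\<lbrakk>x \<in> H; y \<in> H\<rbrakk> \<Longrightarrow> sqnorm ip (x + y) = sqnorm ip x + sqnorm ip y + 2 * Re (ip x y)"
  using ip_commute[of x y] by (simp add: sqnorm_def ip_linear)

lemma sqnorm_diff: "\<lbrakk>x \<in> H; y \<in> H\<rbrakk> \<Longrightarrow> sqnorm ip (x - y) = sqnorm ip x + sqnorm ip y - 2 * Re (ip x y)"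
  using ip_commute[of x y] by (simp add: sqnorm_def ip_linear)

lemma sqnorm_add_le: "\<lbrakk>x \<in> H; y \<in> H\<rbrakk> \<Longrightarrow> sqnorm ip (x + y) \<le> 2 * sqnorm ip x + 2 * sqnorm ip y"
  using sqnorm_add[of x y] sqnorm_diff[of x y] sqnorm_nonneg[of "x - y"] by simp

lemma sqnorm_diff_le: "\<lbrakk>x \<in> H; y \<in> H\<rbrakk> \<Longrightarrow> sqnorm ip (x - y) \<le> 2 * sqnorm ip x + 2 * sqnorm ip y"
  using sqnorm_add[of x y] sqnorm_diff[of x y] sqnorm_nonneg[of "x + y"] by simp

lemma sqnorm_triangle:
  "\<lbrakk>x \<in> H; y \<in> H; w \<in> H\<rbrakk> \<Longrightarrow> sqnorm ip (x - y) \<le> 2 * sqnorm ip (x - w) + 2 * sqnorm ip (y - w)"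
  using sqnorm_diff_le[of "x - w" "y - w"] by simp

lemma abs_Re_ip_le: "\<lbrakk>x \<in> H; y \<in> H\<rbrakk> \<Longrightarrow> \<bar>Re (ip x y)\<bar> \<le> (sqnorm ip x + sqnorm ip y) / 2"
  using sqnorm_add[of x y] sqnorm_diff[of x y] sqnorm_nonneg[of "x + y"] sqnorm_nonneg[of "x - y"]
  by auto

text \<open>A crude bound that suffices for summability of inner products: real and imaginary part
  each cost half of the right-hand side, the imaginary part being a real part after multiplying
  \<open>x\<close> by the imaginary unit.\<close>

lemma cmod_ip_le:
  assumes "x \<in> H" "y \<in> H"
  shows "cmod (ip x y) \<le> sqnorm ip x + sqnorm ip y"
proof -
  have "\<bar>Im (ip x y)\<bar> \<le> (sqnorm ip x + sqnorm ip y) / 2"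
    using abs_Re_ip_le[of "\<i> *\<^sub>C x" y] assms by (simp add: ip_linear sqnorm_scale)
  then show ?thesis
    using abs_Re_ip_le[OF assms] cmod_le[of "ip x y"] by argo
qed

lemma eq_of_ip_eq:
  assumes "x \<in> H" "y \<in> H" "\<And>w. w \<in> H \<Longrightarrow> ip w x = ip w y"
  shows "x = y"
proof -
  have "ip (x - y) (x - y) = 0" using assms by (simp add: ip_linear)
  then show ?thesis using ip_definite[of "x - y"] assms by simp
qed

lemma hnorm_power2: "x \<in> H \<Longrightarrow> (hnorm ip x)\<^sup>2 = sqnorm ip x"
  using sqnorm_nonneg by (simp add: hnorm_def sqnorm_def)

lemma hnorm_tendsto_0_iff:
  assumes "\<And>k. f k \<in> H"
  shows "(\<lambda>k::nat. hnorm ip (f k)) \<longlonglongrightarrow> 0 \<longleftrightarrow> (\<lambda>k. sqnorm ip (f k)) \<longlonglongrightarrow> 0"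
proof
  assume "(\<lambda>k. hnorm ip (f k)) \<longlonglongrightarrow> 0"
  from tendsto_power[OF this, of 2] show "(\<lambda>k. sqnorm ip (f k)) \<longlonglongrightarrow> 0"
    by (simp add: hnorm_power2 assms)
next
  assume "(\<lambda>k. sqnorm ip (f k)) \<longlonglongrightarrow> 0"
  from tendsto_real_sqrt[OF this] show "(\<lambda>k. hnorm ip (f k)) \<longlonglongrightarrow> 0"
    by (simp add: hnorm_def sqnorm_def)
qed

lemma limit_unique:
  assumes "\<And>k. s k \<in> H" "x \<in> H" "y \<in> H"
    and "(\<lambda>k. sqnorm ip (s k - x)) \<longlonglongrightarrow> 0" "(\<lambda>k. sqnorm ip (s k - y)) \<longlonglongrightarrow> 0"
  shows "x = y"
proof -
  have "(\<lambda>k. 2 * sqnorm ip (s k - x) + 2 * sqnorm ip (s k - y)) \<longlonglongrightarrow> 2 * 0 + 2 * 0"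
    by (intro tendsto_intros assms)
  then have "sqnorm ip (x - y) \<le> 2 * 0 + 2 * 0"
  proof (rule LIMSEQ_le_const)
    have "sqnorm ip (x - y) \<le> 2 * sqnorm ip (s k - x) + 2 * sqnorm ip (s k - y)" for k
      using sqnorm_triangle[of x y "s k"] sqnorm_diff_commute[of x "s k"]
        sqnorm_diff_commute[of y "s k"] assms(1)[of k] assms(2,3) by simp
    then show "\<exists>N. \<forall>k\<ge>N. sqnorm ip (x - y) \<le> 2 * sqnorm ip (s k - x) + 2 * sqnorm ip (s k - y)"
      by blast
  qed
  then show ?thesis
    using sqnorm_nonneg[of "x - y"] sqnorm_eq_0_iff[of "x - y"] assms(2,3) by simp
qed

definition cauchy_seq :: "(nat \<Rightarrow> 'a) \<Rightarrow> bool" where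
  "cauchy_seq s \<longleftrightarrow> (\<forall>e>0. \<exists>N. \<forall>m\<ge>N. \<forall>k\<ge>N. sqnorm ip (s m - s k) < e)"

lemma convergent_cauchy:
  assumes "\<And>k. s k \<in> H" "x \<in> H" "(\<lambda>k. sqnorm ip (s k - x)) \<longlonglongrightarrow> 0"
  shows "cauchy_seq s"
  unfolding cauchy_seq_def
proof (intro allI impI)
  fix e :: real assume "e > 0"
  then obtain N where N: "\<And>k. k \<ge> N \<Longrightarrow> sqnorm ip (s k - x) < e / 4"
    using order_tendstoD(2)[OF assms(3), of "e / 4"] by (auto simp: eventually_sequentially)
  have "sqnorm ip (s m - s k) < e" if "m \<ge> N" "k \<ge> N" for m k
    using N[OF that(1)] N[OF that(2)] sqnorm_triangle[OF assms(1)[of m] assms(1)[of k] assms(2)] by argo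
  then show "\<exists>N. \<forall>m\<ge>N. \<forall>k\<ge>N. sqnorm ip (s m - s k) < e" by blast
qed

lemma inner_space_subspace:
  assumes "M \<subseteq> H" "csubspace M"
  shows "inner_space M ip"
proof
  show "ip x y = cnj (ip y x)" if "x \<in> M" "y \<in> M" for x y
    using assms(1) that ip_commute by blast
qed (use assms in \<open>auto simp: subset_iff ip_linear sqnorm_nonneg ip_definite\<close>)

end

locale hilbert = inner_space +
  assumes complete: "\<lbrakk>\<And>k. s k \<in> H; cauchy_seq s\<rbrakk> \<Longrightarrow> \<exists>x\<in>H. (\<lambda>k. sqnorm ip (s k - x)) \<longlonglongrightarrow> 0"

lemma hilbertI:
  assumes "hilbert_space H ip" shows "hilbert H ip"
proof -
  interpret inner_space H ip
  proof
    show "csubspace H" using assms unfolding hilbert_space_def by (elim conjE)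
    show "ip (x + y) w = ip x w + ip y w" if "x \<in> H" "y \<in> H" "w \<in> H" for x y w
      using assms that unfolding hilbert_space_def by (elim conjE) blast
    show "ip (c *\<^sub>C x) y = c * ip x y" if "x \<in> H" "y \<in> H" for c x y
      using assms that unfolding hilbert_space_def by (elim conjE) blast
    show "ip x y = cnj (ip y x)" if "x \<in> H" "y \<in> H" for x y
      using assms that unfolding hilbert_space_def by (elim conjE) blast
    show "0 \<le> sqnorm ip x" if "x \<in> H" for x
      using assms that unfolding hilbert_space_def sqnorm_def by (elim conjE) blast
    show "x = 0" if "x \<in> H" "ip x x = 0" for x
      using assms that unfolding hilbert_space_def by (elim conjE) blast
  qed
  show ?thesis
  proof
    fix s :: "nat \<Rightarrow> 'a"
    assume s: "\<And>k. s k \<in> H" and "cauchy_seq s"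
    have "\<exists>N. \<forall>m\<ge>N. \<forall>k\<ge>N. hnorm ip (s m - s k) < e" if "e > 0" for e
    proof -
      \<comment> \<open>The tolerance is squared because \<open>cauchy_seq\<close> measures squared
        distances, whereas \<open>hilbert_space\<close> speaks of \<open>hnorm\<close>.\<close>
      have "\<exists>N. \<forall>m\<ge>N. \<forall>k\<ge>N. sqnorm ip (s m - s k) < e\<^sup>2"
        using \<open>cauchy_seq s\<close> that unfolding cauchy_seq_def by simp
      then obtain N where N: "\<And>m k. m \<ge> N \<Longrightarrow> k \<ge> N \<Longrightarrow> sqnorm ip (s m - s k) < e\<^sup>2"
        by blast
      have "hnorm ip (s m - s k) < e" if "m \<ge> N" "k \<ge> N" for m k
        using real_sqrt_less_mono[OF N[OF that]] \<open>e > 0\<close> by (simp add: hnorm_def sqnorm_def)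
      then show ?thesis by blast
    qed
    moreover have "\<forall>s. (\<forall>k. s k \<in> H) \<longrightarrow>
          (\<forall>e>0. \<exists>N. \<forall>m\<ge>N. \<forall>k\<ge>N. hnorm ip (s m - s k) < e) \<longrightarrow>
          (\<exists>x\<in>H. (\<lambda>k. hnorm ip (s k - x)) \<longlonglongrightarrow> 0)"
      using assms unfolding hilbert_space_def by (elim conjE)
    ultimately have "\<exists>x\<in>H. (\<lambda>k. hnorm ip (s k - x)) \<longlonglongrightarrow> 0"
      using s by simp
    then show "\<exists>x\<in>H. (\<lambda>k. sqnorm ip (s k - x)) \<longlonglongrightarrow> 0"
      using hnorm_tendsto_0_iff s by auto
  qed
qed

section \<open>Cauchy-Schwarz, continuity of the inner product, orthogonal projection\<close>

context inner_space
begin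

text \<open>The squared distance from \<open>x\<close> to the line through \<open>y\<close>. Its
  nonnegativity is Cauchy-Schwarz, and its strict drop below \<open>sqnorm ip x\<close> shows that
  minimal vectors are orthogonal.\<close>

lemma sqnorm_diff_projection:
  assumes "x \<in> H" "y \<in> H" "y \<noteq> 0"
  shows "sqnorm ip (x - (ip x y / of_real (sqnorm ip y)) *\<^sub>C y)
       = sqnorm ip x - (cmod (ip x y))\<^sup>2 / sqnorm ip y"
proof -
  define c where "c = ip x y / of_real (sqnorm ip y)"
  have pos: "sqnorm ip y > 0"
    using sqnorm_nonneg[of y] sqnorm_eq_0_iff[of y] assms by fastforce
  have "ip x y * cnj (ip x y) = of_real ((cmod (ip x y))\<^sup>2)"
    by (simp add: complex_norm_square del: of_real_power)
  then have "ip x (c *\<^sub>C y) = of_real ((cmod (ip x y))\<^sup>2 / sqnorm ip y)"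
    using assms by (simp add: c_def ip_linear mult.commute)
  moreover have "sqnorm ip (c *\<^sub>C y) = (cmod (ip x y))\<^sup>2 / sqnorm ip y"
    using pos assms
    by (simp add: sqnorm_scale c_def norm_divide power_divide power2_eq_square)
  ultimately show ?thesis
    using sqnorm_diff[of x "c *\<^sub>C y"] assms by (simp add: c_def)
qed

lemma Cauchy_Schwarz:
  assumes "x \<in> H" "y \<in> H"
  shows "(cmod (ip x y))\<^sup>2 \<le> sqnorm ip x * sqnorm ip y"
proof (cases "y = 0")
  case False
  have pos: "sqnorm ip y > 0"
    using sqnorm_nonneg[of y] sqnorm_eq_0_iff[of y] assms False by fastforce
  have "0 \<le> sqnorm ip (x - (ip x y / of_real (sqnorm ip y)) *\<^sub>C y)"
    using assms by (intro sqnorm_nonneg) simp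
  then show ?thesis
    using pos sqnorm_diff_projection[OF assms False] by (simp add: field_simps)
qed (use assms in simp)

text \<open>Here the product form of Cauchy-Schwarz matters: the additive bound
  \<open>cmod_ip_le\<close> would leave a constant \<open>sqnorm ip w\<close> that does not tend to
  0.\<close>

lemma tendsto_ip_left:
  assumes "\<And>k. s k \<in> H" "x \<in> H" "w \<in> H" "(\<lambda>k. sqnorm ip (s k - x)) \<longlonglongrightarrow> 0"
  shows "(\<lambda>k. ip (s k) w) \<longlonglongrightarrow> ip x w"
proof -
  have "(\<lambda>k. sqrt (sqnorm ip (s k - x) * sqnorm ip w)) \<longlonglongrightarrow> sqrt (0 * sqnorm ip w)"
    by (intro tendsto_intros assms)
  then have "(\<lambda>k. sqrt (sqnorm ip (s k - x) * sqnorm ip w)) \<longlonglongrightarrow> 0" by simp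
  moreover have "cmod (ip (s k) w - ip x w) \<le> sqrt (sqnorm ip (s k - x) * sqnorm ip w)" for k
    using Cauchy_Schwarz[of "s k - x" w] assms(1)[of k] assms(2,3)
    by (intro real_le_rsqrt) (simp add: ip_linear)
  ultimately have "(\<lambda>k. ip (s k) w - ip x w) \<longlonglongrightarrow> 0"
    by (metis (mono_tags, lifting) Lim_null_comparison always_eventually)
  then show ?thesis by (rule LIM_zero_cancel)
qed

lemma tendsto_sqnorm:
  assumes "\<And>k. s k \<in> H" "x \<in> H" "(\<lambda>k. sqnorm ip (s k - x)) \<longlonglongrightarrow> 0"
  shows "(\<lambda>k. sqnorm ip (s k)) \<longlonglongrightarrow> sqnorm ip x"
proof -
  \<comment> \<open>The expansion of \<open>sqnorm ip (s k - x)\<close>, solved for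
    \<open>sqnorm ip (s k)\<close>; every term on the left has a known limit.\<close>
  have "(\<lambda>k. 2 * Re (ip (s k) x) - sqnorm ip x + sqnorm ip (s k - x))
      \<longlonglongrightarrow> 2 * Re (ip x x) - sqnorm ip x + 0"
    by (intro tendsto_intros assms tendsto_ip_left)
  moreover have "2 * Re (ip (s k) x) - sqnorm ip x + sqnorm ip (s k - x) = sqnorm ip (s k)" for k
    using sqnorm_diff[of "s k" x] assms(1)[of k] assms(2) by simp
  ultimately show ?thesis by (simp add: sqnorm_def)
qed

text \<open>The parallelogram law for \<open>y - a\<close> and \<open>y - b\<close>, whose sum is
  twice the vector from the midpoint to \<open>y\<close>. It forces near-minimisers of the distance
  to \<open>y\<close> to lie close together.\<close>

lemma parallelogram_midpoint:
  assumes "y \<in> H" "a \<in> H" "b \<in> H"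
  shows "sqnorm ip (a - b) = 2 * sqnorm ip (y - a) + 2 * sqnorm ip (y - b)
       - 4 * sqnorm ip (y - (1 / 2) *\<^sub>C (a + b))"
proof -
  have "2 *\<^sub>C (y - (1 / 2) *\<^sub>C (a + b)) = 2 *\<^sub>C y - (a + b)"
    by (simp add: scaleC_diff_right scaleC_scaleC scaleC_one)
  also have "2 *\<^sub>C y = y + y"
    using scaleC_add_left[of 1 1 y] by (simp add: scaleC_one)
  finally have "sqnorm ip ((y - a) + (y - b)) = 4 * sqnorm ip (y - (1 / 2) *\<^sub>C (a + b))"
    using sqnorm_scale[of "y - (1 / 2) *\<^sub>C (a + b)" 2] assms
    by (simp add: add_diff_add[symmetric])
  moreover have "sqnorm ip ((y - a) - (y - b)) = sqnorm ip (a - b)"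
    using sqnorm_diff_commute[of a b] assms by simp
  ultimately show ?thesis
    using sqnorm_add[of "y - a" "y - b"] sqnorm_diff[of "y - a" "y - b"] assms by simp
qed

text \<open>If \<open>a\<close> had a component along \<open>m\<close>, removing it would give a
  strictly shorter vector of the form \<open>a - m'\<close> with \<open>m'\<close> in
  \<open>M\<close>.\<close>

lemma orthogonal_of_minimal:
  assumes "M \<subseteq> H" "csubspace M" "a \<in> H" "m \<in> M"
    and "\<And>m. m \<in> M \<Longrightarrow> sqnorm ip a \<le> sqnorm ip (a - m)"
  shows "ip m a = 0"
proof (cases "m = 0")
  case False
  have m: "m \<in> H" using assms by auto
  have "(ip a m / of_real (sqnorm ip m)) *\<^sub>C m \<in> M"
    using assms by (auto simp: csubspace_def)
  from assms(5)[OF this] have "(cmod (ip a m))\<^sup>2 / sqnorm ip m \<le> 0"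
    using sqnorm_diff_projection[OF assms(3) m False] by simp
  moreover have "sqnorm ip m > 0"
    using sqnorm_nonneg[of m] sqnorm_eq_0_iff[of m] m False by fastforce
  ultimately have "ip a m = 0" by (simp add: divide_le_0_iff)
  then show ?thesis using ip_commute[OF m assms(3)] by simp
qed (use assms in auto)

theorem orthogonal_projection_exists:
  assumes "hilbert M ip" "M \<subseteq> H" "y \<in> H"
  shows "\<exists>p\<in>M. \<forall>m\<in>M. ip m (y - p) = 0"
proof -
  interpret M: hilbert M ip by fact
  have MH: "m \<in> H" if "m \<in> M" for m using assms that by auto
  define d where "d = Inf ((\<lambda>m. sqnorm ip (y - m)) ` M)"
  have bdd: "bdd_below ((\<lambda>m. sqnorm ip (y - m)) ` M)"
    using assms(3) MH sqnorm_nonneg by (intro bdd_belowI2[where m = 0]) auto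
  have d_le: "d \<le> sqnorm ip (y - m)" if "m \<in> M" for m
    unfolding d_def using bdd that by (rule cINF_lower)
  have "\<exists>m\<in>M. sqnorm ip (y - m) < d + inverse (real (Suc k))" for k
    using cInf_lessD[of "(\<lambda>m. sqnorm ip (y - m)) ` M" "d + inverse (real (Suc k))"] M.zero_in
    by (fastforce simp: d_def simp del: of_nat_Suc)
  then obtain s where s: "\<And>k. s k \<in> M" "\<And>k. sqnorm ip (y - s k) < d + inverse (real (Suc k))"
    by metis
  have "cauchy_seq s"
    unfolding cauchy_seq_def
  proof (intro allI impI)
    fix e :: real assume "e > 0"
    \<comment> \<open>Both squared distances exceed \<open>d\<close> by less than
      \<open>inverse (real (Suc N))\<close> and the midpoint contributes at least \<open>d\<close>,
      so the parallelogram identity leaves less than four times that excess.\<close>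
    then obtain N where N: "inverse (real (Suc N)) < e / 4"
      using reals_Archimedean[of "e / 4"] by auto
    have "sqnorm ip (s m - s k) < e" if "m \<ge> N" "k \<ge> N" for m k
    proof -
      have "(1 / 2) *\<^sub>C (s m + s k) \<in> M" using s by simp
      from d_le[OF this] have "sqnorm ip (s m - s k) \<le> 2 * sqnorm ip (y - s m) + 2 * sqnorm ip (y - s k) - 4 * d"
        using parallelogram_midpoint[OF assms(3) MH[OF s(1)[of m]] MH[OF s(1)[of k]]] by linarith
      moreover have "inverse (real (Suc m)) \<le> inverse (real (Suc N))"
          "inverse (real (Suc k)) \<le> inverse (real (Suc N))"
        using that by (auto intro!: le_imp_inverse_le)
      ultimately show ?thesis using s(2)[of m] s(2)[of k] N by argo
    qed
    then show "\<exists>N. \<forall>m\<ge>N. \<forall>k\<ge>N. sqnorm ip (s m - s k) < e" by blast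
  qed
  then obtain p where p: "p \<in> M" "(\<lambda>k. sqnorm ip (s k - p)) \<longlonglongrightarrow> 0"
    using M.complete[of s] s(1) by blast
  have "(\<lambda>k. sqnorm ip (y - s k)) \<longlonglongrightarrow> sqnorm ip (y - p)"
  proof (rule tendsto_sqnorm)
    have "(y - s k) - (y - p) = p - s k" for k by simp
    then show "(\<lambda>k. sqnorm ip ((y - s k) - (y - p))) \<longlonglongrightarrow> 0"
      using p MH[OF p(1)] MH[OF s(1)] sqnorm_diff_commute[of p] by simp
  qed (use assms(3) MH p s in auto)
  moreover have "(\<lambda>k. d + inverse (real (Suc k))) \<longlonglongrightarrow> d + 0"
    by (intro tendsto_intros LIMSEQ_inverse_real_of_nat)
  ultimately have "sqnorm ip (y - p) \<le> d + 0"
    by (rule LIMSEQ_le) (use s(2) less_imp_le in blast)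
  have "sqnorm ip (y - p) \<le> sqnorm ip (y - p - m)" if "m \<in> M" for m
  proof -
    \<comment> \<open>\<open>p + m\<close> is again in \<open>M\<close>, so minimality of
      \<open>p\<close> over \<open>M\<close> becomes minimality of \<open>y - p\<close> under
      subtracting elements of \<open>M\<close>.\<close>
    have "d \<le> sqnorm ip (y - (p + m))" using that p by (intro d_le) simp
    then show ?thesis using \<open>sqnorm ip (y - p) \<le> d + 0\<close> by (simp add: algebra_simps)
  qed
  then show ?thesis
    using orthogonal_of_minimal[OF assms(2) M.csubspace_carrier] p MH[OF p(1)] assms(3)
    by (meson diff_in)
qed

section \<open>Isometries and existence of adjoints\<close>

lemma
  assumes "isometry_on H ip V"
  shows isometry_in: "x \<in> H \<Longrightarrow> V x \<in> H"
    and isometry_add: "x \<in> H \<Longrightarrow> y \<in> H \<Longrightarrow> V (x + y) = V x + V y"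
    and isometry_scale: "x \<in> H \<Longrightarrow> V (c *\<^sub>C x) = c *\<^sub>C V x"
    and isometry_ip: "x \<in> H \<Longrightarrow> y \<in> H \<Longrightarrow> ip (V x) (V y) = ip x y"
  using assms by (auto simp: isometry_on_def clinear_on_def)

lemma
  assumes iso: "isometry_on H ip V"
  shows isometry_zero: "V 0 = 0"
    and isometry_diff: "x \<in> H \<Longrightarrow> y \<in> H \<Longrightarrow> V (x - y) = V x - V y"
    and isometry_sqnorm: "x \<in> H \<Longrightarrow> sqnorm ip (V x) = sqnorm ip x"
proof -
  show "V 0 = 0" using isometry_scale[OF iso, of 0 0] by simp
  show "V (x - y) = V x - V y" if "x \<in> H" "y \<in> H"
    using isometry_add[OF iso, of x "- y"] isometry_scale[OF iso, of y "- 1"] that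
    by (simp add: scaleC_minus_one)
  show "sqnorm ip (V x) = sqnorm ip x" if "x \<in> H"
    using isometry_ip[OF iso that that] by (simp add: sqnorm_def)
qed

lemma isometry_inj:
  assumes "isometry_on H ip V" "x \<in> H" "y \<in> H" "V x = V y" shows "x = y"
  using isometry_diff[OF assms(1-3)] isometry_sqnorm[OF assms(1), of "x - y"] assms
    sqnorm_eq_0_iff[of "x - y"] by simp

lemma isometry_funpow: "isometry_on H ip V \<Longrightarrow> isometry_on H ip (V ^^ N)"
proof (induction N)
  case 0
  then show ?case by (auto simp: isometry_on_def clinear_on_def)
next
  case (Suc N)
  note iso = Suc.prems and isoN = Suc.IH[OF Suc.prems]
  show ?case
    unfolding isometry_on_def clinear_on_def
    by (auto simp: isometry_in[OF iso] isometry_in[OF isoN] isometry_add[OF iso] isometry_add[OF isoN]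
        isometry_scale[OF iso] isometry_scale[OF isoN] isometry_ip[OF iso] isometry_ip[OF isoN])
qed

text \<open>Existence is a hypothesis because the choice behind \<open>adj\<close> carries
  information only once some adjoint is known.\<close>

lemma
  assumes "\<exists>T'. T' ` H \<subseteq> H \<and> (\<forall>x\<in>H. \<forall>y\<in>H. ip (T x) y = ip x (T' y))"
  shows adj_in: "y \<in> H \<Longrightarrow> adj H ip T y \<in> H"
    and ip_adj: "x \<in> H \<Longrightarrow> y \<in> H \<Longrightarrow> ip (T x) y = ip x (adj H ip T y)"
  using someI_ex[OF assms] unfolding adj_def by blast+

text \<open>An explicit candidate supplies existence and, by uniqueness, the value as well. The
  adjoints of the standard operators are identified in this way.\<close>

lemma adj_eqI:
  assumes "\<And>x. x \<in> H \<Longrightarrow> T' x \<in> H" "\<And>x y. x \<in> H \<Longrightarrow> y \<in> H \<Longrightarrow> ip (T x) y = ip x (T' y)" "y \<in> H"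
  shows "adj H ip T y = T' y"
proof (rule eq_of_ip_eq)
  have ex: "\<exists>T'. T' ` H \<subseteq> H \<and> (\<forall>x\<in>H. \<forall>y\<in>H. ip (T x) y = ip x (T' y))"
    using assms by blast
  show "adj H ip T y \<in> H" "T' y \<in> H" using adj_in[OF ex] assms by auto
  show "ip w (adj H ip T y) = ip w (T' y)" if "w \<in> H" for w
    using ip_adj[OF ex that assms(3)] assms(2)[OF that assms(3)] by simp
qed

end

context hilbert
begin

text \<open>\<open>V\<close> preserves distances: a Cauchy sequence in the range pulls back to one
  in \<open>H\<close>, and its limit is pushed forward again.\<close>

lemma isometry_range_hilbert:
  assumes iso: "isometry_on H ip V"
  shows "hilbert (V ` H) ip"
proof -
  have sub: "V ` H \<subseteq> H" using isometry_in[OF iso] by auto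
  have "csubspace (V ` H)"
    unfolding csubspace_def
  proof (intro conjI ballI allI)
    show "0 \<in> V ` H" using isometry_zero[OF iso] zero_in by (metis imageI)
    show "x + y \<in> V ` H" if "x \<in> V ` H" "y \<in> V ` H" for x y
    proof -
      from that obtain a b where "a \<in> H" "b \<in> H" "x = V a" "y = V b" by blast
      then show ?thesis using isometry_add[OF iso, of a b] by (intro image_eqI[of _ _ "a + b"]) simp_all
    qed
    show "c *\<^sub>C x \<in> V ` H" if "x \<in> V ` H" for c x
    proof -
      from that obtain a where "a \<in> H" "x = V a" by blast
      then show ?thesis using isometry_scale[OF iso, of a c] by (intro image_eqI[of _ _ "c *\<^sub>C a"]) simp_all
    qed
  qed
  from inner_space_subspace[OF sub this] show ?thesis
  proof (rule hilbert.intro[OF _ hilbert_axioms.intro])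
    fix s :: "nat \<Rightarrow> 'a" assume s: "\<And>k. s k \<in> V ` H" and cau: "cauchy_seq s"
    from s have "\<forall>k. \<exists>t\<in>H. s k = V t" by blast
    then obtain t where t: "\<And>k. t k \<in> H" "\<And>k. s k = V (t k)" by metis
    have eq: "sqnorm ip (V u - V v) = sqnorm ip (u - v)" if "u \<in> H" "v \<in> H" for u v
      using isometry_diff[OF iso that] isometry_sqnorm[OF iso, of "u - v"] that by simp
    have "cauchy_seq t" using cau by (simp add: cauchy_seq_def t eq)
    then obtain x where "x \<in> H" "(\<lambda>k. sqnorm ip (t k - x)) \<longlonglongrightarrow> 0"
      using complete[of t, OF t(1)] by blast
    then show "\<exists>x\<in>V ` H. (\<lambda>k. sqnorm ip (s k - x)) \<longlonglongrightarrow> 0"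
      using t eq by auto
  qed
qed

text \<open>Project \<open>y\<close> onto the range of \<open>V\<close> and write the projection as
  \<open>V u\<close>. The residual is orthogonal to the range, so pairing \<open>y\<close> with
  \<open>V x\<close> is pairing \<open>V u\<close> with \<open>V x\<close>, that is \<open>u\<close>
  with \<open>x\<close>; hence \<open>u\<close> is the value of the adjoint at
  \<open>y\<close>.\<close>

lemma isometry_adjoint_exists:
  assumes iso: "isometry_on H ip V"
  shows "\<exists>T'. T' ` H \<subseteq> H \<and> (\<forall>x\<in>H. \<forall>y\<in>H. ip (V x) y = ip x (T' y))"
proof -
  have "\<exists>u\<in>H. \<forall>x\<in>H. ip (V x) y = ip x u" if "y \<in> H" for y
  proof -
    from orthogonal_projection_exists[OF isometry_range_hilbert[OF iso] _ that] isometry_in[OF iso]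
    obtain u where u: "u \<in> H" "\<And>x. x \<in> H \<Longrightarrow> ip (V x) (y - V u) = 0" by auto
    have "ip (V x) y = ip x u" if "x \<in> H" for x
      using u(2)[OF that] isometry_ip[OF iso that u(1)] isometry_in[OF iso] that u(1) \<open>y \<in> H\<close>
      by (simp add: ip_linear)
    then show ?thesis using u by blast
  qed
  then obtain T' where "\<And>y. y \<in> H \<Longrightarrow> T' y \<in> H \<and> (\<forall>x\<in>H. ip (V x) y = ip x (T' y))"
    by metis
  then show ?thesis by blast
qed

end

section \<open>The Wold decomposition of a single isometry\<close>

text \<open>A complete subspace is closed: the sequence also has a limit inside \<open>M\<close>,
  and limits are unique.\<close>

lemma (in inner_space) limit_in_hilbert_subspace:
  assumes "hilbert M ip" "M \<subseteq> H" "\<And>k. s k \<in> M" "x \<in> H" "(\<lambda>k. sqnorm ip (s k - x)) \<longlonglongrightarrow> 0"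
  shows "x \<in> M"
proof -
  have s: "s k \<in> H" for k using assms(2,3) by auto
  have "cauchy_seq s" by (rule convergent_cauchy[OF s assms(4,5)])
  then obtain y where y: "y \<in> M" "(\<lambda>k. sqnorm ip (s k - y)) \<longlonglongrightarrow> 0"
    using hilbert.complete[OF assms(1), of s] assms(3) by blast
  have "x = y" by (rule limit_unique[OF s assms(4) _ assms(5) y(2)]) (use y assms(2) in auto)
  then show ?thesis using y by simp
qed

text \<open>The \<open>P\<close> of the overview: for an isometry, the orthogonal projection onto
  the kernel of the adjoint, that is onto the complement of the range.\<close>

definition defect :: "'a::complex_vector set \<Rightarrow> ('a \<Rightarrow> 'a \<Rightarrow> complex) \<Rightarrow> ('a \<Rightarrow> 'a) \<Rightarrow> 'a \<Rightarrow> 'a" where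
  "defect H ip V x = x - V (adj H ip V x)"

locale isometry = hilbert +
  fixes V :: "'a \<Rightarrow> 'a"
  assumes iso: "isometry_on H ip V"
begin

abbreviation "V_adj \<equiv> adj H ip V"
abbreviation "D \<equiv> defect H ip V"

lemmas V_in [simp] = isometry_in[OF iso]
  and V_add = isometry_add[OF iso]
  and V_scale = isometry_scale[OF iso]
  and V_ip = isometry_ip[OF iso]
  and V_zero [simp] = isometry_zero[OF iso]
  and V_diff = isometry_diff[OF iso]
  and V_sqnorm = isometry_sqnorm[OF iso]
  and V_inj = isometry_inj[OF iso]
  and V_adj_in [simp] = adj_in[OF isometry_adjoint_exists[OF iso]]
  and ip_V_adj = ip_adj[OF isometry_adjoint_exists[OF iso]]

lemma ip_V_adj_left: "x \<in> H \<Longrightarrow> y \<in> H \<Longrightarrow> ip (V_adj x) y = ip x (V y)"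
  using ip_V_adj[of y x] ip_commute[of x "V y"] ip_commute[of "V_adj x" y] by simp

lemma V_adj_V [simp]: "x \<in> H \<Longrightarrow> V_adj (V x) = x"
  by (rule eq_of_ip_eq) (simp_all add: ip_V_adj[symmetric] V_ip)

lemma V_adj_add: "x \<in> H \<Longrightarrow> y \<in> H \<Longrightarrow> V_adj (x + y) = V_adj x + V_adj y"
  by (rule eq_of_ip_eq) (simp_all add: ip_V_adj[symmetric] ip_linear)

lemma V_adj_scale: "x \<in> H \<Longrightarrow> V_adj (c *\<^sub>C x) = c *\<^sub>C V_adj x"
  by (rule eq_of_ip_eq) (simp_all add: ip_V_adj[symmetric] ip_linear)

lemma V_adj_diff: "x \<in> H \<Longrightarrow> y \<in> H \<Longrightarrow> V_adj (x - y) = V_adj x - V_adj y"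
  by (rule eq_of_ip_eq) (simp_all add: ip_V_adj[symmetric] ip_linear)

lemma defect_in [simp]: "x \<in> H \<Longrightarrow> D x \<in> H"
  by (simp add: defect_def)

lemma defect_add: "x \<in> H \<Longrightarrow> y \<in> H \<Longrightarrow> D (x + y) = D x + D y"
  by (simp add: defect_def V_add V_adj_add)

lemma defect_scale: "x \<in> H \<Longrightarrow> D (c *\<^sub>C x) = c *\<^sub>C D x"
  by (simp add: defect_def V_scale V_adj_scale scaleC_diff_right)

lemma V_adj_defect: "x \<in> H \<Longrightarrow> V_adj (D x) = 0"
  by (simp add: defect_def V_adj_diff)

lemma defect_V: "x \<in> H \<Longrightarrow> D (V x) = 0"
  by (simp add: defect_def)

text \<open>Pythagoras for the splitting of \<open>x\<close> into \<open>D x\<close> and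
  \<open>V (V_adj x)\<close>, where \<open>V\<close> drops out of the second norm. This is the
  telescoping identity.\<close>

lemma sqnorm_defect: "x \<in> H \<Longrightarrow> sqnorm ip (D x) + sqnorm ip (V_adj x) = sqnorm ip x"
  using ip_V_adj_left[of x "V_adj x"]
  by (simp add: defect_def sqnorm_diff V_sqnorm) (simp add: sqnorm_def)

lemma V_adj_pow_in [simp]: "x \<in> H \<Longrightarrow> (V_adj ^^ k) x \<in> H"
  by (induction k) simp_all

lemma V_adj_pow_add: "x \<in> H \<Longrightarrow> y \<in> H \<Longrightarrow> (V_adj ^^ k) (x + y) = (V_adj ^^ k) x + (V_adj ^^ k) y"
  by (induction k) (simp_all add: V_adj_add)

lemma V_adj_pow_scale: "x \<in> H \<Longrightarrow> (V_adj ^^ k) (c *\<^sub>C x) = c *\<^sub>C (V_adj ^^ k) x"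
  by (induction k) (simp_all add: V_adj_scale)

lemma isometry_pow: "isometry_on H ip (V ^^ k)"
  by (rule isometry_funpow[OF iso])

lemma V_pow_in [simp]: "x \<in> H \<Longrightarrow> (V ^^ k) x \<in> H"
  by (rule isometry_in[OF isometry_pow])

lemma ip_V_adj_pow: "x \<in> H \<Longrightarrow> y \<in> H \<Longrightarrow> ip ((V ^^ k) x) y = ip x ((V_adj ^^ k) y)"
proof (induction k arbitrary: y)
  case (Suc k)
  have "ip ((V ^^ k) x) (V_adj y) = ip x ((V_adj ^^ k) (V_adj y))"
    by (rule Suc.IH) (use Suc.prems in auto)
  then show ?case
    using Suc.prems by (simp add: ip_V_adj funpow_swap1[of V_adj])
qed simp

lemma sqnorm_range_residual:
  assumes "x \<in> H"
  shows "sqnorm ip (x - (V ^^ k) ((V_adj ^^ k) x)) = sqnorm ip x - sqnorm ip ((V_adj ^^ k) x)"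
proof -
  have "ip ((V ^^ k) ((V_adj ^^ k) x)) x = ip ((V_adj ^^ k) x) ((V_adj ^^ k) x)"
    using assms by (simp add: ip_V_adj_pow)
  then have "Re (ip x ((V ^^ k) ((V_adj ^^ k) x))) = sqnorm ip ((V_adj ^^ k) x)"
    using ip_commute[of x "(V ^^ k) ((V_adj ^^ k) x)"] assms by (simp add: sqnorm_def)
  then show ?thesis
    using assms by (simp add: sqnorm_diff isometry_sqnorm[OF isometry_pow])
qed

text \<open>The intersection of the ranges is the unitary part in the Wold decomposition. Each range
  is complete, hence closed, which makes the intersection an admissible test subspace in
  \<open>pure_isometry\<close>.\<close>

lemma closed_csubspace_range_Inter:
  "closed_csubspace H ip (\<Inter>k. (V ^^ k) ` H)"
proof -
  have range: "hilbert ((V ^^ k) ` H) ip" "(V ^^ k) ` H \<subseteq> H" for k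
    using isometry_range_hilbert[OF isometry_pow] by auto
  have sub: "csubspace ((V ^^ k) ` H)" for k
    using range(1)[of k] by (simp add: hilbert_def inner_space_def)
  have csub: "csubspace (\<Inter>k. (V ^^ k) ` H)"
    unfolding csubspace_def
  proof (intro conjI ballI allI INT_I)
    fix k x y c
    show "0 \<in> (V ^^ k) ` H" using sub[of k] unfolding csubspace_def by blast
    assume x: "x \<in> (\<Inter>k. (V ^^ k) ` H)"
    then show "c *\<^sub>C x \<in> (V ^^ k) ` H" using sub[of k] unfolding csubspace_def by blast
    assume "y \<in> (\<Inter>k. (V ^^ k) ` H)"
    then show "x + y \<in> (V ^^ k) ` H" using x sub[of k] unfolding csubspace_def by blast
  qed
  have subH: "(\<Inter>k. (V ^^ k) ` H) \<subseteq> H" using range(2)[of 0] by fast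
  have lim: "x \<in> (V ^^ j) ` H"
    if s: "\<And>k. s k \<in> (\<Inter>k. (V ^^ k) ` H)" "x \<in> H" "(\<lambda>k. hnorm ip (s k - x)) \<longlonglongrightarrow> 0" for s x j
  proof (rule limit_in_hilbert_subspace[OF range])
    show sj: "s k \<in> (V ^^ j) ` H" for k using s(1)[of k] by blast
    have d: "s k - x \<in> H" for k using sj[of k] range(2)[of j] s(2) by (intro diff_in) blast+
    show "(\<lambda>k. sqnorm ip (s k - x)) \<longlonglongrightarrow> 0"
      using s(3) hnorm_tendsto_0_iff[of "\<lambda>k. s k - x", OF d] by simp
  qed fact
  show ?thesis
    unfolding closed_csubspace_def
  proof (intro conjI allI impI INT_I csub subH)
    fix s :: "nat \<Rightarrow> 'a" and x j
    assume "\<forall>k. s k \<in> (\<Inter>k. (V ^^ k) ` H)"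
    then have "s k \<in> (\<Inter>k. (V ^^ k) ` H)" for k by (rule spec)
    then show "x \<in> H \<Longrightarrow> (\<lambda>k. hnorm ip (s k - x)) \<longlonglongrightarrow> 0 \<Longrightarrow> x \<in> (V ^^ j) ` H"
      by (rule lim)
  qed
qed

text \<open>One inclusion moves the extra \<open>V\<close> inside the power. The other looks one
  power further, at \<open>Suc k\<close>, and cancels a \<open>V\<close> by injectivity.\<close>

lemma V_image_range_Inter: "V ` (\<Inter>k. (V ^^ k) ` H) = (\<Inter>k. (V ^^ k) ` H)"
proof (intro equalityI subsetI)
  fix y assume "y \<in> V ` (\<Inter>k. (V ^^ k) ` H)"
  then obtain x where x: "\<And>k. x \<in> (V ^^ k) ` H" "y = V x" by blast
  have "y \<in> (V ^^ k) ` H" for k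
  proof -
    obtain u where u: "u \<in> H" "x = (V ^^ k) u" using x(1)[of k] by blast
    then have "y = (V ^^ k) (V u)" using x(2) by (simp add: funpow_swap1)
    then show ?thesis using u by simp
  qed
  then show "y \<in> (\<Inter>k. (V ^^ k) ` H)" by blast
next
  fix y assume y: "y \<in> (\<Inter>k. (V ^^ k) ` H)"
  then have "y \<in> (V ^^ 1) ` H" by blast
  then obtain x where x: "x \<in> H" "y = V x" by auto
  have "x \<in> (V ^^ k) ` H" for k
  proof -
    have "y \<in> (V ^^ Suc k) ` H" using y by blast
    then obtain u where u: "u \<in> H" "y = V ((V ^^ k) u)" by auto
    then have "x = (V ^^ k) u" using x V_inj[of x "(V ^^ k) u"] by simp
    then show ?thesis using u by simp
  qed
  then show "y \<in> V ` (\<Inter>k. (V ^^ k) ` H)" using x by blast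
qed

lemma unitary_on_subset:
  assumes "M \<subseteq> H" "V ` M = M"
  shows "unitary_on M ip V"
proof -
  have "x \<in> H" if "x \<in> M" for x using that assms(1) by blast
  then show ?thesis
    unfolding unitary_on_def isometry_on_def clinear_on_def
    using assms(2) V_add V_scale V_ip by simp
qed

lemma range_Inter_of_pure:
  assumes "pure_isometry H ip V"
  shows "(\<Inter>k. (V ^^ k) ` H) = {0}"
proof -
  let ?M = "\<Inter>k. (V ^^ k) ` H"
  have sub: "?M \<subseteq> H" using closed_csubspace_range_Inter by (simp add: closed_csubspace_def)
  have "unitary_on ?M ip V" by (rule unitary_on_subset[OF sub V_image_range_Inter])
  then show ?thesis
    using assms closed_csubspace_range_Inter equalityD1[OF V_image_range_Inter]
    unfolding pure_isometry_def by blast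
qed

text \<open>The vectors \<open>y k\<close> are the projections of \<open>x\<close> onto the
  decreasing ranges of \<open>V ^^ k\<close>. Their squared norms \<open>a k\<close> decrease, and
  squared distances between them are differences of these numbers, so \<open>y\<close> is Cauchy.
  Its limit lies in every range and is therefore 0 by purity.\<close>

lemma pure_adj_pow_tendsto_0:
  assumes pure: "pure_isometry H ip V" and x: "x \<in> H"
  shows "(\<lambda>k. sqnorm ip ((V_adj ^^ k) x)) \<longlonglongrightarrow> 0"
proof -
  define a where "a k = sqnorm ip ((V_adj ^^ k) x)" for k
  define y where "y k = (V ^^ k) ((V_adj ^^ k) x)" for k
  have y_in: "y k \<in> H" for k using x by (simp add: y_def)
  have "a (Suc k) \<le> a k" for k
    using sqnorm_defect[of "(V_adj ^^ k) x"] sqnorm_nonneg[of "D ((V_adj ^^ k) x)"] x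
    by (simp add: a_def)
  then have "decseq a" by (rule decseq_SucI)
  moreover have "0 \<le> a k" for k using x by (simp add: a_def sqnorm_nonneg)
  ultimately obtain L where "a \<longlonglongrightarrow> L" using decseq_convergent[of a 0] by blast
  then have cau: "Cauchy a" by (rule LIMSEQ_imp_Cauchy)
  have diff: "sqnorm ip (y k - y (k + j)) = a k - a (k + j)" for k j
  proof -
    let ?u = "(V_adj ^^ k) x"
    have "(V_adj ^^ (k + j)) x = (V_adj ^^ j) ?u"
      by (metis add.commute comp_apply funpow_add)
    then have "y k - y (k + j) = (V ^^ k) (?u - (V ^^ j) ((V_adj ^^ j) ?u))"
      using x by (simp add: y_def funpow_add isometry_diff[OF isometry_pow])
    then show ?thesis
      using x sqnorm_range_residual[of ?u j] \<open>(V_adj ^^ (k + j)) x = (V_adj ^^ j) ?u\<close>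
      by (simp add: a_def isometry_sqnorm[OF isometry_pow])
  qed
  have le: "sqnorm ip (y k - y m) \<le> \<bar>a k - a m\<bar>" for k m
  proof (cases "k \<le> m")
    case True
    then show ?thesis using diff[of k "m - k"] by simp
  next
    case False
    then show ?thesis
      using diff[of m "k - m"] sqnorm_diff_commute[OF y_in[of k] y_in[of m]] by simp
  qed
  have "cauchy_seq y"
    unfolding cauchy_seq_def
  proof (intro allI impI)
    fix e :: real assume "e > 0"
    then obtain N where "\<forall>m\<ge>N. \<forall>k\<ge>N. \<bar>a m - a k\<bar> < e"
      using cau unfolding Cauchy_def dist_real_def by blast
    then show "\<exists>N. \<forall>m\<ge>N. \<forall>k\<ge>N. sqnorm ip (y m - y k) < e"
      using le le_less_trans by blast
  qed
  then obtain p where p: "p \<in> H" "(\<lambda>k. sqnorm ip (y k - p)) \<longlonglongrightarrow> 0"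
    using complete[of y] y_in by blast
  have "p \<in> (V ^^ j) ` H" for j
  proof (rule limit_in_hilbert_subspace)
    show "hilbert ((V ^^ j) ` H) ip" by (rule isometry_range_hilbert[OF isometry_pow])
    \<comment> \<open>Dropping the first \<open>j\<close> terms puts the whole sequence into the
      range of \<open>V ^^ j\<close>.\<close>
    show "y (k + j) \<in> (V ^^ j) ` H" for k
      using x by (simp add: y_def add.commute[of k j] funpow_add)
    show "(\<lambda>k. sqnorm ip (y (k + j) - p)) \<longlonglongrightarrow> 0"
      using LIMSEQ_ignore_initial_segment[OF p(2)] .
  qed (use p in auto)
  then have "p = 0" using range_Inter_of_pure[OF pure] by blast
  moreover have "sqnorm ip (y k) = a k" for k
    using x by (simp add: y_def a_def isometry_sqnorm[OF isometry_pow])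
  ultimately show ?thesis using p(2) by (simp add: a_def)
qed

lemma defect_has_sum:
  assumes "pure_isometry H ip V" and x: "x \<in> H"
  shows "((\<lambda>k. sqnorm ip (D ((V_adj ^^ k) x))) has_sum sqnorm ip x) UNIV"
proof -
  have "(\<Sum>k<N. sqnorm ip (D ((V_adj ^^ k) x))) = sqnorm ip x - sqnorm ip ((V_adj ^^ N) x)" for N
  proof (induction N)
    case (Suc N)
    then show ?case using sqnorm_defect[of "(V_adj ^^ N) x"] x by simp
  qed simp
  moreover have "(\<lambda>N. sqnorm ip x - sqnorm ip ((V_adj ^^ N) x)) \<longlonglongrightarrow> sqnorm ip x - 0"
    by (intro tendsto_intros pure_adj_pow_tendsto_0 assms)
  ultimately have "(\<lambda>k. sqnorm ip (D ((V_adj ^^ k) x))) sums sqnorm ip x"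
    by (simp add: sums_def)
  then show ?thesis
    by (rule sums_nonneg_imp_has_sum) (use x in \<open>simp add: sqnorm_nonneg\<close>)
qed

end

section \<open>The space of square-summable families\<close>

lemma idx_fun_upd: "k \<in> idx l \<Longrightarrow> i \<in> {1..l} \<Longrightarrow> k(i := m) \<in> idx l"
  by (auto simp: idx_def)

lemma zero_in_idx [simp]: "(\<lambda>_. 0) \<in> idx l"
  by (simp add: idx_def)

lemma basis_tensor_apply: "basis_tensor k x k' = (if k' = k then x else 0)"
  by (simp add: basis_tensor_def)

text \<open>Expanding the norm of a sum recovers the real part of the inner product; the imaginary
  part is the same statement for the imaginary unit times \<open>x\<close>.\<close>

lemma polarization:
  assumes "inner_space H ip" "inner_space H' ip'" "\<Phi> ` H \<subseteq> H'" "clinear_on H \<Phi>"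
    and norm: "\<And>x. x \<in> H \<Longrightarrow> sqnorm ip' (\<Phi> x) = sqnorm ip x"
    and "x \<in> H" "y \<in> H"
  shows "ip' (\<Phi> x) (\<Phi> y) = ip x y"
proof -
  interpret A: inner_space H ip by fact
  interpret B: inner_space H' ip' by fact
  have \<Phi>: "\<Phi> u \<in> H'" if "u \<in> H" for u using that assms(3) by auto
  have Re: "Re (ip' (\<Phi> u) (\<Phi> v)) = Re (ip u v)" if "u \<in> H" "v \<in> H" for u v
  proof -
    have "\<Phi> (u + v) = \<Phi> u + \<Phi> v" using assms(4) that by (simp add: clinear_on_def)
    then show ?thesis
      using A.sqnorm_add[OF that] B.sqnorm_add[OF \<Phi>[OF that(1)] \<Phi>[OF that(2)]]
        norm[of "u + v"] norm[OF that(1)] norm[OF that(2)] that by simp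
  qed
  have "\<Phi> (\<i> *\<^sub>C x) = \<i> *\<^sub>C \<Phi> x" using assms(4,6) by (simp add: clinear_on_def)
  then have "Re (\<i> * ip' (\<Phi> x) (\<Phi> y)) = Re (\<i> * ip x y)"
    using Re[of "\<i> *\<^sub>C x" y] assms(6,7) \<Phi> by (simp add: A.ip_linear B.ip_linear)
  then show ?thesis
    using Re[OF assms(6,7)] by (simp add: complex_eq_iff)
qed

context inner_space
begin

lemma mem_l2tensor_iff:
  "f \<in> l2tensor l H ip \<longleftrightarrow> (\<forall>k. f k \<in> H) \<and> (\<forall>k. k \<notin> idx l \<longrightarrow> f k = 0) \<and>
     (\<lambda>k. sqnorm ip (f k)) summable_on idx l"
proof -
  have "(\<lambda>k. (hnorm ip (f k))\<^sup>2) = (\<lambda>k. sqnorm ip (f k))" if "\<forall>k. f k \<in> H"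
    using that by (simp add: hnorm_power2)
  then show ?thesis unfolding l2tensor_def by auto
qed

lemma
  assumes "f \<in> l2tensor l H ip"
  shows l2tensor_in: "f k \<in> H"
    and l2tensor_outside: "k \<notin> idx l \<Longrightarrow> f k = 0"
    and l2tensor_summable: "(\<lambda>k. sqnorm ip (f k)) summable_on idx l"
  using assms by (auto simp: mem_l2tensor_iff)

lemma l2tensorI_bound:
  assumes "\<And>k. f k \<in> H" "\<And>k. k \<notin> idx l \<Longrightarrow> f k = 0"
    and "g summable_on idx l" "\<And>k. k \<in> idx l \<Longrightarrow> sqnorm ip (f k) \<le> g k"
  shows "f \<in> l2tensor l H ip"
  using assms summable_on_comparison_test[OF assms(3,4)]
  by (simp add: mem_l2tensor_iff sqnorm_nonneg)

lemma l2tensor_zero: "0 \<in> l2tensor l H ip"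
  by (simp add: mem_l2tensor_iff)

lemma l2tensor_add:
  assumes f: "f \<in> l2tensor l H ip" and g: "g \<in> l2tensor l H ip"
  shows "f + g \<in> l2tensor l H ip"
proof (rule l2tensorI_bound)
  show "(\<lambda>k. 2 * sqnorm ip (f k) + 2 * sqnorm ip (g k)) summable_on idx l"
    by (intro summable_on_add summable_on_cmult_right l2tensor_summable f g)
qed (use l2tensor_in[OF f] l2tensor_in[OF g] l2tensor_outside[OF f] l2tensor_outside[OF g]
      in \<open>simp_all add: sqnorm_add_le\<close>)

lemma l2tensor_scale:
  assumes f: "f \<in> l2tensor l H ip"
  shows "c *\<^sub>C f \<in> l2tensor l H ip"
proof (rule l2tensorI_bound)
  show "(\<lambda>k. (cmod c)\<^sup>2 * sqnorm ip (f k)) summable_on idx l"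
    by (intro summable_on_cmult_right l2tensor_summable f)
qed (use l2tensor_in[OF f] l2tensor_outside[OF f] in \<open>simp_all add: sqnorm_scale\<close>)

lemma ip_summable:
  assumes f: "f \<in> l2tensor l H ip" and g: "g \<in> l2tensor l H ip"
  shows "(\<lambda>k. ip (f k) (g k)) summable_on idx l"
proof (rule abs_summable_summable, rule summable_on_comparison_test)
  show "(\<lambda>k. sqnorm ip (f k) + sqnorm ip (g k)) summable_on idx l"
    by (intro summable_on_add l2tensor_summable f g)
qed (use l2tensor_in[OF f] l2tensor_in[OF g] in \<open>simp_all add: cmod_ip_le\<close>)

lemma l2ip_has_sum:
  assumes "f \<in> l2tensor l H ip" "g \<in> l2tensor l H ip"
  shows "((\<lambda>k. ip (f k) (g k)) has_sum l2ip l ip f g) (idx l)"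
  unfolding l2ip_def by (rule has_sum_infsum[OF ip_summable[OF assms]])

lemma sqnorm_l2_has_sum:
  assumes "f \<in> l2tensor l H ip"
  shows "((\<lambda>k. sqnorm ip (f k)) has_sum sqnorm (l2ip l ip) f) (idx l)"
  using has_sum_Re[OF l2ip_has_sum[OF assms assms]] by (simp add: sqnorm_def)

lemma sqnorm_le_l2:
  assumes "f \<in> l2tensor l H ip"
  shows "sqnorm ip (f k) \<le> sqnorm (l2ip l ip) f"
proof -
  have nonneg: "0 \<le> sqnorm ip (f k)" for k
    using l2tensor_in[OF assms] sqnorm_nonneg by blast
  have "0 \<le> sqnorm (l2ip l ip) f"
    using has_sum_nonneg[OF sqnorm_l2_has_sum[OF assms]] nonneg by simp
  moreover have "sqnorm ip (f k) \<le> sqnorm (l2ip l ip) f" if "k \<in> idx l"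
    using finite_sum_le_has_sum[OF sqnorm_l2_has_sum[OF assms], of "{k}"] that nonneg by simp
  ultimately show ?thesis using l2tensor_outside[OF assms, of k] by fastforce
qed

lemma inner_space_l2tensor: "inner_space (l2tensor l H ip) (l2ip l ip)"
proof
  show "csubspace (l2tensor l H ip)"
    unfolding csubspace_def using l2tensor_zero l2tensor_add l2tensor_scale by blast
  fix f g h c
  assume f: "f \<in> l2tensor l H ip"
  note has = l2ip_has_sum
  show "0 \<le> sqnorm (l2ip l ip) f"
    by (rule has_sum_nonneg[OF sqnorm_l2_has_sum[OF f]]) (simp add: l2tensor_in[OF f] sqnorm_nonneg)
  show "f = 0" if "l2ip l ip f f = 0"
  proof
    fix k
    have "sqnorm ip (f k) = 0"
      using sqnorm_le_l2[OF f, of k] sqnorm_nonneg[OF l2tensor_in[OF f, of k]] that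
      by (simp add: sqnorm_def)
    then show "f k = 0 k" using sqnorm_eq_0_iff l2tensor_in[OF f] by simp
  qed
  assume g: "g \<in> l2tensor l H ip"
  show "l2ip l ip (c *\<^sub>C f) g = c * l2ip l ip f g"
    using has_sum_cmult_right[OF has[OF f g], of c] has[OF l2tensor_scale[OF f] g]
      l2tensor_in[OF f] l2tensor_in[OF g]
    by (intro has_sum_unique[OF has[OF l2tensor_scale[OF f] g]]) (simp add: ip_linear)
  show "l2ip l ip f g = cnj (l2ip l ip g f)"
    unfolding l2ip_def infsum_cnj[symmetric]
    by (rule infsum_cong) (rule ip_commute[OF l2tensor_in[OF f] l2tensor_in[OF g]])
  assume h: "h \<in> l2tensor l H ip"
  show "l2ip l ip (f + g) h = l2ip l ip f h + l2ip l ip g h"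
    using has_sum_add[OF has[OF f h] has[OF g h]] l2tensor_in[OF f] l2tensor_in[OF g] l2tensor_in[OF h]
    by (intro has_sum_unique[OF has[OF l2tensor_add[OF f g] h]]) (simp add: ip_linear)
qed

lemma basis_tensor_in_l2:
  assumes "k \<in> idx l" "x \<in> H"
  shows "basis_tensor k x \<in> l2tensor l H ip"
proof -
  have "(\<lambda>k'. sqnorm ip (basis_tensor k x k')) summable_on idx l \<longleftrightarrow>
      (\<lambda>k'. sqnorm ip (basis_tensor k x k')) summable_on {k}"
    using assms by (intro summable_on_cong_neutral) (auto simp: basis_tensor_apply)
  then show ?thesis
    using assms by (auto simp: mem_l2tensor_iff basis_tensor_apply)
qed

lemma l2ip_basis_tensor:
  assumes "k \<in> idx l" "x \<in> H" "y \<in> H"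
  shows "l2ip l ip (basis_tensor k x) (basis_tensor k y) = ip x y"
proof -
  have "l2ip l ip (basis_tensor k x) (basis_tensor k y)
      = (\<Sum>\<^sub>\<infinity>k'\<in>{k}. ip (basis_tensor k x k') (basis_tensor k y k'))"
    unfolding l2ip_def using assms by (intro infsum_cong_neutral) (auto simp: basis_tensor_apply)
  then show ?thesis by (simp add: basis_tensor_apply)
qed

lemma finite_support_in_csubspace:
  assumes "csubspace R" "\<And>k. k \<in> idx l \<Longrightarrow> basis_tensor k (f k) \<in> R" "finite F" "F \<subseteq> idx l"
  shows "(\<lambda>k. if k \<in> F then f k else 0) \<in> R"
  using assms(3,4)
proof (induction F rule: finite_induct)
  case empty
  have "(\<lambda>k. if k \<in> {} then f k else 0) = 0" by (simp add: fun_eq_iff)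
  then show ?case using assms(1) by (simp add: csubspace_def)
next
  case (insert k F)
  have "(\<lambda>k'. if k' \<in> insert k F then f k' else 0)
      = basis_tensor k (f k) + (\<lambda>k. if k \<in> F then f k else 0)"
    using insert.hyps by (intro ext) (auto simp: basis_tensor_apply)
  then show ?case
    using insert.IH insert.prems assms(1,2) unfolding csubspace_def by simp
qed

text \<open>The squared error of truncating to \<open>F\<close> is the total mass minus the mass on
  \<open>F\<close>, and unordered convergence of the total provides an \<open>F\<close> with gap
  below \<open>e\<close>.\<close>

lemma finite_support_approximation:
  assumes f: "f \<in> l2tensor l H ip" and "e > 0"
  shows "\<exists>F. finite F \<and> F \<subseteq> idx l \<and>
    sqnorm (l2ip l ip) ((\<lambda>k. if k \<in> F then f k else 0) - f) < e"
proof -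
  define g where "g k = sqnorm ip (f k)" for k
  define S where "S = sqnorm (l2ip l ip) f"
  have g: "(g has_sum S) (idx l)" unfolding g_def S_def by (rule sqnorm_l2_has_sum[OF f])
  then obtain F where F: "finite F" "F \<subseteq> idx l" "dist (sum g F) S < e"
    using tendstoD[OF g[unfolded has_sum_def] \<open>e > 0\<close>]
    unfolding eventually_finite_subsets_at_top by blast
  define h where "h = (\<lambda>k. if k \<in> F then f k else 0) - f"
  have h_apply: "h k = (if k \<in> F then 0 else - f k)" for k by (simp add: h_def)
  have h: "h \<in> l2tensor l H ip"
    by (rule l2tensorI_bound[OF _ _ l2tensor_summable[OF f]])
      (use l2tensor_in[OF f] l2tensor_outside[OF f] in \<open>simp_all add: h_apply sqnorm_minus sqnorm_nonneg\<close>)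
  have "((\<lambda>k. if k \<in> F then g k else 0) has_sum sum g F) (idx l) \<longleftrightarrow> (g has_sum sum g F) F"
    using F(2) by (intro has_sum_cong_neutral) auto
  then have "((\<lambda>k. if k \<in> F then g k else 0) has_sum sum g F) (idx l)"
    using F(1) by (simp add: has_sum_finite)
  \<comment> \<open>At each index one of error and truncation carries \<open>g k\<close> and the
    other is 0, so the two masses add up to \<open>S\<close>.\<close>
  from has_sum_add[OF sqnorm_l2_has_sum[OF h] this]
  have "(g has_sum (sqnorm (l2ip l ip) h + sum g F)) (idx l)"
    by (rule has_sum_cong[THEN iffD1, rotated])
      (use l2tensor_in[OF f] in \<open>simp add: h_apply g_def sqnorm_minus\<close>)
  from has_sum_unique[OF this g] have "sqnorm (l2ip l ip) h = S - sum g F" by simp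
  then show ?thesis using F by (auto simp: h_def dist_real_def)
qed

end

section \<open>The Wold decomposition of a tuple\<close>

lemma prod_ops_image:
  assumes "\<And>j. j \<in> set js \<Longrightarrow> V j ` K = K"
  shows "prod_ops V js m ` K = K"
  using assms
proof (induction js)
  case (Cons j js)
  have "(V j ^^ N) ` K = K" for N
  proof (induction N)
    case (Suc N)
    have "(V j ^^ Suc N) ` K = V j ` (V j ^^ N) ` K" by (simp add: image_image)
    then show ?case using Suc Cons.prems[of j] by simp
  qed simp
  moreover have "prod_ops V (j # js) m ` K = (V j ^^ m j) ` prod_ops V js m ` K"
    by (simp add: image_image)
  ultimately show ?case using Cons by simp
qed simp

text \<open>If the remaining operators map the joint kernel onto itself, so does every product of
  their powers, and the intersection collapses to the kernel.\<close>

lemma wandering_eq: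
  assumes "\<And>j. j \<in> {1..n} - A \<Longrightarrow> V j ` {x\<in>H. \<forall>i\<in>A. adj H ip (V i) x = 0}
      = {x\<in>H. \<forall>i\<in>A. adj H ip (V i) x = 0}"
  shows "wandering n H ip V A = {x\<in>H. \<forall>i\<in>A. adj H ip (V i) x = 0}"
  unfolding wandering_def Let_def using assms by (subst prod_ops_image) auto

lemma std_op_basis:
  assumes "i \<in> {1..l}" "k \<in> idx l"
  shows "std_op z l U i (basis_tensor k x)
    = (\<Prod>j\<in>{1..<i}. z i j ^ k j) *\<^sub>C basis_tensor (k(i := Suc (k i))) x"
proof
  fix k'
  show "std_op z l U i (basis_tensor k x) k'
    = ((\<Prod>j\<in>{1..<i}. z i j ^ k j) *\<^sub>C basis_tensor (k(i := Suc (k i))) x) k'"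
  proof (cases "k' = k(i := Suc (k i))")
    case True
    \<comment> \<open>The phase sees only coordinates below \<open>i\<close>, where
      \<open>k'\<close> and \<open>k\<close> agree, so it may be read off before or after the
      shift.\<close>
    have "(\<Prod>j\<in>{1..<i}. z i j ^ k' j) = (\<Prod>j\<in>{1..<i}. z i j ^ k j)"
      by (rule prod.cong) (auto simp: True)
    moreover have "k'(i := k' i - 1) = k" by (simp add: True)
    moreover have "1 \<le> k' i" by (simp add: True)
    moreover have "k' \<in> idx l" using idx_fun_upd[OF assms(2,1)] by (simp add: True)
    ultimately show ?thesis
      using assms(1) by (simp add: std_op_def basis_tensor_apply True[symmetric] del: fun_upd_apply)
  next
    case False
    have "k'(i := k' i - 1) \<noteq> k" if "1 \<le> k' i"
    proof
      assume "k'(i := k' i - 1) = k"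
      then have "k(i := Suc (k i)) = k'" using that by auto
      with False show False by simp
    qed
    then show ?thesis using assms(1) False by (simp add: std_op_def basis_tensor_apply)
  qed
qed

section \<open>Commutation relations of a doubly non-commuting tuple\<close>

locale dnc_tuple = hilbert +
  fixes n :: nat and z :: "nat \<Rightarrow> nat \<Rightarrow> complex" and V :: "nat \<Rightarrow> 'a \<Rightarrow> 'a"
  assumes z_unimodular: "\<lbrakk>i \<in> {1..n}; j \<in> {1..n}; i \<noteq> j\<rbrakk> \<Longrightarrow> cmod (z i j) = 1"
    and z_commute: "\<lbrakk>i \<in> {1..n}; j \<in> {1..n}; i \<noteq> j\<rbrakk> \<Longrightarrow> z j i = cnj (z i j)"
    and dnc: "dnc n z H ip V"
begin

abbreviation "Va i \<equiv> adj H ip (V i)"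
abbreviation "Df i \<equiv> defect H ip (V i)"

lemma isom: "i \<in> {1..n} \<Longrightarrow> isometry H ip (V i)"
  using dnc unfolding dnc_def by (intro isometry.intro isometry_axioms.intro hilbert_axioms) blast

lemmas V_in [simp] = isometry.V_in[OF isom]
  and V_add = isometry.V_add[OF isom]
  and V_scale = isometry.V_scale[OF isom]
  and V_diff = isometry.V_diff[OF isom]
  and V_zero [simp] = isometry.V_zero[OF isom]
  and V_inj = isometry.V_inj[OF isom]
  and Va_in [simp] = isometry.V_adj_in[OF isom]
  and Va_scale = isometry.V_adj_scale[OF isom]
  and Va_diff = isometry.V_adj_diff[OF isom]
  and Va_V [simp] = isometry.V_adj_V[OF isom]
  and Va_pow_in [simp] = isometry.V_adj_pow_in[OF isom]
  and Va_pow_add = isometry.V_adj_pow_add[OF isom]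
  and Va_pow_scale = isometry.V_adj_pow_scale[OF isom]
  and Df_in [simp] = isometry.defect_in[OF isom]
  and Df_add = isometry.defect_add[OF isom]
  and Df_scale = isometry.defect_scale[OF isom]

lemma z_mult: "\<lbrakk>i \<in> {1..n}; j \<in> {1..n}; i \<noteq> j\<rbrakk> \<Longrightarrow> z i j * z j i = 1"
  using z_unimodular[of i j] z_commute[of i j] complex_norm_square[of "z i j"] by simp

lemma Va_zero [simp]: "i \<in> {1..n} \<Longrightarrow> Va i 0 = 0"
  using Va_scale[of i 0 0] by simp

lemma Df_zero [simp]: "i \<in> {1..n} \<Longrightarrow> Df i 0 = 0"
  using Df_scale[of i 0 0] by simp

lemma Va_pow_zero [simp]: "i \<in> {1..n} \<Longrightarrow> (Va i ^^ k) 0 = 0"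
  using Va_pow_scale[of i 0 k 0] by simp

lemma Va_V_other:
  assumes "i \<in> {1..n}" "j \<in> {1..n}" "i \<noteq> j" "x \<in> H"
  shows "Va i (V j x) = z j i *\<^sub>C V j (Va i x)"
  using dnc assms z_commute[OF assms(1-3)] unfolding dnc_def by simp

text \<open>Both sides have the same norm as \<open>x\<close>, and the assumed relation computes
  their inner product as \<open>ip x x\<close>. Expanding the squared norm of the difference then
  gives 0.\<close>

lemma V_commute:
  assumes ij: "i \<in> {1..n}" "j \<in> {1..n}" "i \<noteq> j" and x: "x \<in> H"
  shows "V i (V j x) = z i j *\<^sub>C V j (V i x)"
proof -
  have "ip (V i (V j x)) (V j (V i x)) = ip (V j x) (Va i (V j (V i x)))"
    using ij x by (intro isometry.ip_V_adj[OF isom]) auto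
  also have "\<dots> = z i j * ip (V j x) (V j x)"
    using ij x z_commute[of i j] by (simp add: Va_V_other ip_linear)
  also have "ip (V j x) (V j x) = ip x x"
    using ij x by (simp add: isometry.V_ip[OF isom])
  finally have "ip (V i (V j x)) (V j (V i x)) = z i j * ip x x" .
  moreover have "cnj (z i j) * z i j = 1"
    using z_mult[OF ij] z_commute[OF ij] by (simp add: mult.commute)
  ultimately have "ip (V i (V j x)) (z i j *\<^sub>C V j (V i x)) = ip x x"
    using ij x by (simp add: ip_scale_right mult.assoc[symmetric])
  then have "sqnorm ip (V i (V j x) - z i j *\<^sub>C V j (V i x)) = 0"
    using ij x z_unimodular[of i j]
    by (simp add: sqnorm_diff sqnorm_scale isometry.V_sqnorm[OF isom]) (simp add: sqnorm_def)
  then show ?thesis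
    using sqnorm_eq_0_iff[of "V i (V j x) - z i j *\<^sub>C V j (V i x)"] ij x by simp
qed

lemma Va_commute:
  assumes ij: "i \<in> {1..n}" "j \<in> {1..n}" "i \<noteq> j" and x: "x \<in> H"
  shows "Va j (Va i x) = z j i *\<^sub>C Va i (Va j x)"
proof (rule eq_of_ip_eq)
  fix w assume w: "w \<in> H"
  have "ip w (Va j (Va i x)) = ip (V i (V j w)) x"
    using ij w x by (simp add: isometry.ip_V_adj[OF isom, symmetric])
  also have "\<dots> = ip w (z j i *\<^sub>C Va i (Va j x))"
    using ij w x z_commute[of i j]
    by (simp add: V_commute[OF ij w] ip_linear isometry.ip_V_adj[OF isom, symmetric])
  finally show "ip w (Va j (Va i x)) = ip w (z j i *\<^sub>C Va i (Va j x))" .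
qed (use ij x in auto)

text \<open>\<open>V j\<close> picks up \<open>z j i\<close> from the adjoint of \<open>V i\<close>
  and \<open>z i j\<close> from \<open>V i\<close>; these are inverse to each other, so the
  projection commutes with \<open>V j\<close> exactly.\<close>

lemma Df_V_other:
  assumes ij: "i \<in> {1..n}" "j \<in> {1..n}" "i \<noteq> j" and x: "x \<in> H"
  shows "Df i (V j x) = V j (Df i x)"
  using assms z_mult[of i j]
  by (simp add: defect_def Va_V_other V_scale V_commute[of i j] V_diff scaleC_scaleC mult.commute scaleC_one)

lemma Df_Va_other:
  assumes ij: "i \<in> {1..n}" "j \<in> {1..n}" "i \<noteq> j" and x: "x \<in> H"
  shows "Df i (Va j x) = Va j (Df i x)"
  using assms z_mult[of i j]
  by (simp add: defect_def Va_diff Va_V_other[of j i] Va_commute[of i j] V_scale scaleC_scaleC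
      mult.commute scaleC_one)

text \<open>One factor per passage: this is the origin of the powers \<open>z i j ^ k j\<close> in
  \<open>std_op\<close>.\<close>

lemma Va_pow_V_other:
  assumes ij: "i \<in> {1..n}" "j \<in> {1..n}" "i \<noteq> j" and x: "x \<in> H"
  shows "(Va i ^^ k) (V j x) = (z j i ^ k) *\<^sub>C V j ((Va i ^^ k) x)"
proof (induction k)
  case (Suc k)
  then show ?case
    using assms by (simp add: Va_scale Va_V_other scaleC_scaleC mult.commute)
qed (simp add: scaleC_one)

lemma Va_Va_pow_other:
  assumes ij: "i \<in> {1..n}" "j \<in> {1..n}" "i \<noteq> j" and x: "x \<in> H"
  shows "Va j ((Va i ^^ k) x) = (z j i ^ k) *\<^sub>C (Va i ^^ k) (Va j x)"
proof (induction k)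
  case (Suc k)
  then show ?case
    using assms by (simp add: Va_commute[of i j] Va_scale scaleC_scaleC)
qed (simp add: scaleC_one)

text \<open>Coordinate 1 is innermost, which matches the product over smaller indices in
  \<open>std_op\<close>. The recursion counts the coordinates already treated, so that properties of
  the full coefficient follow by adding one coordinate at a time.\<close>

primrec coeff :: "nat \<Rightarrow> (nat \<Rightarrow> nat) \<Rightarrow> 'a \<Rightarrow> 'a" where
  "coeff 0 k x = x"
| "coeff (Suc i) k x = Df (Suc i) ((Va (Suc i) ^^ k (Suc i)) (coeff i k x))"

lemma coeff_in [simp]: "i \<le> n \<Longrightarrow> x \<in> H \<Longrightarrow> coeff i k x \<in> H"
  by (induction i) simp_all

lemma coeff_add: "\<lbrakk>i \<le> n; x \<in> H; y \<in> H\<rbrakk> \<Longrightarrow> coeff i k (x + y) = coeff i k x + coeff i k y"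
  by (induction i) (simp_all add: Va_pow_add Df_add)

lemma coeff_scale: "\<lbrakk>i \<le> n; x \<in> H\<rbrakk> \<Longrightarrow> coeff i k (c *\<^sub>C x) = c *\<^sub>C coeff i k x"
  by (induction i) (simp_all add: Va_pow_scale Df_scale)

lemma coeff_cong: "(\<And>m. m \<in> {1..i} \<Longrightarrow> k m = k' m) \<Longrightarrow> coeff i k x = coeff i k' x"
  by (induction i) simp_all

lemma coeff_V_above:
  assumes "j \<in> {1..n}" "i < j" and x: "x \<in> H"
  shows "coeff i k (V j x) = (\<Prod>m\<in>{1..i}. z j m ^ k m) *\<^sub>C V j (coeff i k x)"
  using assms(2)
proof (induction i)
  case (Suc i)
  have Si: "Suc i \<in> {1..n}" "Suc i \<noteq> j" using Suc.prems assms(1) by auto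
  show ?case
    using Suc Si assms(1) x
    by (simp add: Va_pow_scale Va_pow_V_other[OF Si(1) assms(1) Si(2)] Df_scale
        Df_V_other[OF Si(1) assms(1) Si(2)] scaleC_scaleC prod.nat_ivl_Suc' mult.commute)
qed (simp add: scaleC_one)

text \<open>Coordinates below \<open>j\<close> are passed at the cost of a phase. At coordinate
  \<open>j\<close> one adjoint cancels \<open>V j\<close>, or, when \<open>k j\<close> is 0, the
  projection annihilates the range of \<open>V j\<close>. Later coordinates only act on the
  result.\<close>

lemma coeff_V:
  assumes "1 \<le> j" "j \<le> i" "i \<le> n" and x: "x \<in> H"
  shows "coeff i k (V j x) = (if 1 \<le> k j
    then (\<Prod>m\<in>{1..<j}. z j m ^ k m) *\<^sub>C coeff i (k(j := k j - 1)) x else 0)"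
  using assms(2,3)
proof (induction i)
  case (Suc i)
  have Si: "Suc i \<in> {1..n}" using Suc.prems by auto
  show ?case
  proof (cases "j = Suc i")
    case True
    let ?c = "\<Prod>m\<in>{1..i}. z j m ^ k m"
    have "coeff (Suc i) k (V j x) = ?c *\<^sub>C Df j ((Va j ^^ k j) (V j (coeff i k x)))"
      using Si True x coeff_V_above[of j i x k] by (simp add: Va_pow_scale Df_scale)
    moreover have "{1..i} = {1..<j}" using True by auto
    moreover have "Df j ((Va j ^^ k j) (V j (coeff i k x))) = 0" if "k j = 0"
      using that True Si x by (simp add: isometry.defect_V[OF isom])
    moreover have "Df j ((Va j ^^ k j) (V j (coeff i k x))) = coeff (Suc i) (k(j := k j - 1)) x"
      if kj: "1 \<le> k j"
    proof -
      obtain m where m: "k j = Suc m" using kj by (cases "k j") auto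
      have "(Va j ^^ k j) (V j (coeff i k x)) = (Va j ^^ m) (coeff i k x)"
        using True Si x unfolding m funpow_Suc_right by simp
      \<comment> \<open>Here \<open>j = Suc i\<close>, so the lowered entry is not among the
        coordinates that \<open>coeff i\<close> reads.\<close>
      moreover have "coeff i (k(j := k j - 1)) x = coeff i k x"
        by (rule coeff_cong) (use True in auto)
      ultimately show ?thesis using True m by simp
    qed
    ultimately show ?thesis
      by (cases "k j = 0") (simp_all add: Suc_le_eq del: coeff.simps fun_upd_apply)
  next
    case False
    then have "j \<le> i" using Suc.prems by simp
    then show ?thesis
      using Suc.IH Suc.prems False Si x by (simp add: Va_pow_scale Df_scale)
  qed
qed (use assms(1) in simp)

text \<open>The adjoint of \<open>V j\<close> kills the projection applied at coordinate
  \<open>j\<close>, and it passes all later factors up to a phase. This places the coefficients in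
  the wandering subspace.\<close>

lemma Va_coeff:
  assumes "1 \<le> j" "j \<le> i" "i \<le> n" and x: "x \<in> H"
  shows "Va j (coeff i k x) = 0"
  using assms(2,3)
proof (induction i)
  case (Suc i)
  have Si: "Suc i \<in> {1..n}" using Suc.prems by auto
  show ?case
  proof (cases "j = Suc i")
    case True
    then show ?thesis using Si x by (simp add: isometry.V_adj_defect[OF isom])
  next
    case False
    then have j: "j \<in> {1..n}" "j \<le> i" using Suc.prems assms(1) by auto
    then have "Va j (coeff i k x) = 0" using Suc.IH Suc.prems by simp
    then show ?thesis
      using Si j False x Suc.prems Df_Va_other[of "Suc i" j, symmetric] Va_Va_pow_other[of "Suc i" j]
      by simp
  qed
qed (use assms(1) in simp)

text \<open>Each projection fixes such an \<open>x\<close>, whereas any positive power of an adjoint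
  kills it. Thus vectors of the wandering subspace go to elementary tensors at index 0.\<close>

lemma coeff_fixed:
  assumes "i \<le> n" "x \<in> H" "\<And>j. j \<in> {1..i} \<Longrightarrow> Va j x = 0"
  shows "coeff i k x = (if \<forall>m\<in>{1..i}. k m = 0 then x else 0)"
  using assms(1,3)
proof (induction i)
  case (Suc i)
  have Si: "Suc i \<in> {1..n}" using Suc.prems by auto
  have IH: "coeff i k x = (if \<forall>m\<in>{1..i}. k m = 0 then x else 0)"
    using Suc by simp
  have "Df (Suc i) x = x" using Suc.prems(2)[of "Suc i"] Si by (simp add: defect_def)
  moreover have "(Va (Suc i) ^^ k (Suc i)) x = 0" if "k (Suc i) \<noteq> 0"
    using that Suc.prems(2)[of "Suc i"] Si
    by (cases "k (Suc i)") (simp_all del: funpow.simps add: funpow_Suc_right)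
  moreover have "(\<forall>m\<in>{1..Suc i}. k m = 0) \<longleftrightarrow> (\<forall>m\<in>{1..i}. k m = 0) \<and> k (Suc i) = 0"
    by (auto simp: le_Suc_eq)
  ultimately show ?case using IH Si by auto
qed simp

text \<open>Summing out the last coordinate is \<open>defect_has_sum\<close> for the vector
  \<open>coeff i k x\<close>, which returns the sum of the previous level. As the terms are
  nonnegative, iterated summability gives summability over the product of index sets.\<close>

lemma coeff_has_sum:
  assumes "i \<le> n" "\<And>j. j \<in> {1..i} \<Longrightarrow> pure_isometry H ip (V j)" "x \<in> H"
  shows "((\<lambda>k. sqnorm ip (coeff i k x)) has_sum sqnorm ip x) (idx i)"
  using assms(1,2)
proof (induction i)
  case 0
  have "idx 0 = {\<lambda>_. 0}" by (auto simp: idx_def)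
  then show ?case by (simp add: has_sum_finite_iff)
next
  case (Suc i)
  have Si: "Suc i \<in> {1..n}" using Suc.prems by auto
  let ?g = "\<lambda>(k, m). k(Suc i := m)"
  have bij: "bij_betw ?g (idx i \<times> UNIV) (idx (Suc i))"
  proof (rule bij_betw_byWitness[where f' = "\<lambda>k. (k(Suc i := 0), k (Suc i))"])
    show "?g ` (idx i \<times> UNIV) \<subseteq> idx (Suc i)"
      "(\<lambda>k. (k(Suc i := 0), k (Suc i))) ` idx (Suc i) \<subseteq> idx i \<times> UNIV"
      by (auto simp: idx_def)
  qed (auto simp: idx_def fun_eq_iff)
  have IH: "((\<lambda>k. sqnorm ip (coeff i k x)) has_sum sqnorm ip x) (idx i)"
    using Suc by simp
  let ?h = "\<lambda>(k, m). sqnorm ip (Df (Suc i) ((Va (Suc i) ^^ m) (coeff i k x)))"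
  have inner: "((\<lambda>m. ?h (k, m)) has_sum sqnorm ip (coeff i k x)) UNIV" for k
    using isometry.defect_has_sum[OF isom[OF Si], of "coeff i k x"] Suc.prems(2)[of "Suc i"] Si assms(3)
    by simp
  have "?h summable_on idx i \<times> UNIV"
    using Si assms(3)
    by (intro summable_on_SigmaI[OF inner] has_sum_imp_summable[OF IH]) (simp add: sqnorm_nonneg)
  from has_sum_SigmaI[OF inner IH this]
  have "((\<lambda>p. sqnorm ip (coeff (Suc i) (?g p) x)) has_sum sqnorm ip x) (idx i \<times> UNIV)"
  proof (rule has_sum_cong[THEN iffD1, rotated], clarify)
    fix k :: "nat \<Rightarrow> nat" and m
    have "coeff i (k(Suc i := m)) x = coeff i k x" by (rule coeff_cong) auto
    then show "sqnorm ip (Df (Suc i) ((Va (Suc i) ^^ m) (coeff i k x)))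
        = sqnorm ip (coeff (Suc i) (k(Suc i := m)) x)" by simp
  qed
  then show ?case
    by (subst (asm) has_sum_reindex_bij_betw[OF bij])
qed

end

section \<open>Unitary equivalence with the standard tuple\<close>

locale wold_tuple = dnc_tuple +
  fixes l :: nat
  assumes l_le: "l \<le> n"
    and pure: "i \<in> {1..l} \<Longrightarrow> pure_isometry H ip (V i)"
    and unitary: "i \<in> {l+1..n} \<Longrightarrow> unitary_on H ip (V i)"
begin

text \<open>Only the joint kernel; that it equals the wandering subspace is
  \<open>wandering_eq_W\<close>.\<close>

definition W :: "'a set" where
  "W = {x \<in> H. \<forall>i\<in>{1..l}. Va i x = 0}"

definition \<Phi> :: "'a \<Rightarrow> (nat \<Rightarrow> nat) \<Rightarrow> 'a" where
  "\<Phi> x = (\<lambda>k. if k \<in> idx l then coeff l k x else 0)"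

abbreviation "L \<equiv> l2tensor l W ip"
abbreviation "lip \<equiv> l2ip l ip"

lemma index_le: "i \<in> {1..l} \<Longrightarrow> i \<in> {1..n}"
  using l_le by auto

lemma W_subset: "W \<subseteq> H"
  by (auto simp: W_def)

lemma csubspace_W: "csubspace W"
  unfolding csubspace_def W_def
  using l_le by (auto simp: Va_scale isometry.V_adj_add[OF isom])

lemma inner_space_W: "inner_space W ip"
  by (rule inner_space_subspace[OF W_subset csubspace_W])

text \<open>For \<open>i\<close> in \<open>{1..l}\<close> the adjoint of \<open>V i\<close> kills
  \<open>V j x\<close> exactly when it kills \<open>x\<close>, since the phase is nonzero and
  \<open>V j\<close> is injective. Surjectivity of the unitary \<open>V j\<close> on
  \<open>H\<close> then descends to \<open>W\<close>.\<close>

lemma V_image_W: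
  assumes j: "j \<in> {1..n} - {1..l}"
  shows "V j ` W = W"
proof (intro equalityI subsetI)
  have comm: "Va i (V j x) = z j i *\<^sub>C V j (Va i x)" if "i \<in> {1..l}" "x \<in> H" for i x
    using that j by (intro Va_V_other) (auto dest: index_le)
  fix y assume "y \<in> V j ` W"
  then show "y \<in> W"
    using j l_le comm by (auto simp: W_def)
next
  fix y assume y: "y \<in> W"
  have jn: "j \<in> {1..n}" using j by auto
  have "V j ` H = H" using unitary[of j] j by (auto simp: unitary_on_def)
  then obtain x where x: "x \<in> H" "y = V j x" using y W_subset by blast
  have "Va i x = 0" if i: "i \<in> {1..l}" for i
  proof -
    have ij: "i \<in> {1..n}" "i \<noteq> j" using i j index_le[OF i] by auto
    have "z j i \<noteq> 0" using z_unimodular[OF jn ij(1)] ij by auto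
    moreover have "z j i *\<^sub>C V j (Va i x) = z j i *\<^sub>C 0"
      using y x i Va_V_other[OF ij(1) jn ij(2) x(1)] by (simp add: W_def)
    ultimately have "V j (Va i x) = 0" by (rule scaleC_cancel)
    then show ?thesis using V_inj[OF jn, of "Va i x" 0] V_zero[OF jn] ij x by simp
  qed
  then show "y \<in> V j ` W" using x by (auto simp: W_def)
qed

lemma wandering_eq_W: "wandering n H ip V {1..l} = W"
  unfolding W_def by (rule wandering_eq) (use V_image_W in \<open>simp add: W_def\<close>)

lemma coeff_in_W: "x \<in> H \<Longrightarrow> coeff l k x \<in> W"
  using Va_coeff[of _ l x k] l_le by (auto simp: W_def)

lemma
  assumes x: "x \<in> H"
  shows \<Phi>_in: "\<Phi> x \<in> L" and \<Phi>_sqnorm: "sqnorm lip (\<Phi> x) = sqnorm ip x"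
proof -
  interpret W: inner_space W ip by (rule inner_space_W)
  have "((\<lambda>k. sqnorm ip (coeff l k x)) has_sum sqnorm ip x) (idx l)"
    by (rule coeff_has_sum[OF l_le pure x])
  then have has: "((\<lambda>k. sqnorm ip (\<Phi> x k)) has_sum sqnorm ip x) (idx l)"
    by (rule has_sum_cong[THEN iffD1, rotated]) (simp add: \<Phi>_def)
  then show in_L: "\<Phi> x \<in> L"
    using coeff_in_W[OF x] has_sum_imp_summable[OF has]
    by (auto simp: W.mem_l2tensor_iff \<Phi>_def)
  show "sqnorm lip (\<Phi> x) = sqnorm ip x"
    by (rule has_sum_unique[OF W.sqnorm_l2_has_sum[OF in_L] has])
qed

lemma \<Phi>_linear: "clinear_on H \<Phi>"
  unfolding clinear_on_def \<Phi>_def using l_le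
  by (auto simp: fun_eq_iff coeff_add coeff_scale)

text \<open>The standard tuple is formed with \<open>V\<close> itself: coefficients of
  \<open>\<Phi> x\<close> lie in \<open>W\<close>, so for \<open>i > l\<close> only the restriction
  of \<open>V i\<close> to \<open>W\<close> is ever applied.\<close>

lemma \<Phi>_V:
  assumes i: "i \<in> {1..n}" and x: "x \<in> H"
  shows "\<Phi> (V i x) = std_op z l V i (\<Phi> x)"
proof
  fix k
  show "\<Phi> (V i x) k = std_op z l V i (\<Phi> x) k"
  proof (cases "i \<le> l")
    case True
    then have "k(i := k i - 1) \<in> idx l" if "k \<in> idx l"
      using that i by (intro idx_fun_upd) auto
    then show ?thesis
      using True i x l_le coeff_V[of i l x k] by (simp add: std_op_def \<Phi>_def del: fun_upd_apply)
  next
    case False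
    then show ?thesis
      using i x coeff_V_above[of i l x k] by (simp add: std_op_def \<Phi>_def)
  qed
qed

lemma csubspace_range: "csubspace (\<Phi> ` H)"
  unfolding csubspace_def
proof (intro conjI ballI allI)
  have add: "\<Phi> (x + y) = \<Phi> x + \<Phi> y" if "x \<in> H" "y \<in> H" for x y
    using \<Phi>_linear that by (simp add: clinear_on_def)
  have scale: "\<Phi> (c *\<^sub>C x) = c *\<^sub>C \<Phi> x" if "x \<in> H" for c x
    using \<Phi>_linear that by (simp add: clinear_on_def)
  have "\<Phi> 0 = 0" using scale[of 0 0] by simp
  then show "0 \<in> \<Phi> ` H" using zero_in by (metis imageI)
  fix f g c assume "f \<in> \<Phi> ` H"
  then obtain x where x: "x \<in> H" "f = \<Phi> x" by blast
  then show "c *\<^sub>C f \<in> \<Phi> ` H" using scale[of x c] by (intro image_eqI[of _ _ "c *\<^sub>C x"]) simp_all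
  assume "g \<in> \<Phi> ` H"
  then obtain y where y: "y \<in> H" "g = \<Phi> y" by blast
  then show "f + g \<in> \<Phi> ` H" using add[of x y] x by (intro image_eqI[of _ _ "x + y"]) simp_all
qed

text \<open>Induction on the total degree of \<open>k\<close>: degree 0 is the image of
  \<open>w\<close> itself, and applying some \<open>V i\<close> raises coordinate \<open>i\<close>
  up to a nonzero phase, which can be divided out inside the subspace.\<close>

lemma basis_tensor_in_range:
  assumes "k \<in> idx l" "w \<in> W"
  shows "basis_tensor k w \<in> \<Phi> ` H"
  using assms(1)
proof (induction "\<Sum>i\<in>{1..l}. k i" arbitrary: k rule: less_induct)
  case less
  show ?case
  proof (cases "\<forall>i\<in>{1..l}. k i = 0")
    case True
    have "\<Phi> w = basis_tensor k w"
    proof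
      fix k'
      have zero: "k'' = (\<lambda>_. 0) \<longleftrightarrow> (\<forall>m\<in>{1..l}. k'' m = 0)" if "k'' \<in> idx l" for k''
        using that unfolding idx_def fun_eq_iff by blast
      have "k' = k \<longleftrightarrow> (\<forall>m\<in>{1..l}. k' m = 0)" if "k' \<in> idx l"
        using zero[OF that] zero[OF less.prems] True by simp
      then show "\<Phi> w k' = basis_tensor k w k'"
        using assms(2) less.prems coeff_fixed[OF l_le, of w k']
        by (auto simp: \<Phi>_def W_def basis_tensor_apply)
    qed
    then show ?thesis using assms(2) W_subset by (metis imageI subsetD)
  next
    case False
    then obtain i where i: "i \<in> {1..l}" "k i \<noteq> 0" by blast
    let ?k = "k(i := k i - 1)"
    have k: "?k(i := Suc (?k i)) = k" using i by auto
    have "(\<Sum>i\<in>{1..l}. ?k i) < (\<Sum>i\<in>{1..l}. k i)"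
      by (rule sum_strict_mono_ex1) (use i in auto)
    then obtain x where x: "x \<in> H" "basis_tensor ?k w = \<Phi> x"
      using less.hyps[of ?k] idx_fun_upd[OF less.prems i(1)] by blast
    let ?c = "\<Prod>j\<in>{1..<i}. z i j ^ ?k j"
    have "\<Phi> (V i x) = ?c *\<^sub>C basis_tensor k w"
      using \<Phi>_V[OF index_le[OF i(1)] x(1)] x(2)
        std_op_basis[OF i(1) idx_fun_upd[OF less.prems i(1)], of z V "k i - 1" w] k
      by (simp del: fun_upd_apply)
    moreover have "z i j \<noteq> 0" if "j \<in> {1..<i}" for j
      using z_unimodular[of i j] i(1) that l_le by auto
    then have "?c \<noteq> 0" by simp
    ultimately have "basis_tensor k w = inverse ?c *\<^sub>C \<Phi> (V i x)"
      by (simp add: scaleC_scaleC scaleC_one del: fun_upd_apply)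
    moreover have "\<Phi> (V i x) \<in> \<Phi> ` H" using x index_le[OF i(1)] by simp
    ultimately show ?thesis using csubspace_range unfolding csubspace_def by metis
  qed
qed

lemma \<Phi>_surj: "\<Phi> ` H = L"
proof (intro equalityI subsetI)
  interpret W: inner_space W ip by (rule inner_space_W)
  interpret L: inner_space L lip by (rule W.inner_space_l2tensor)
  fix f assume f: "f \<in> L"
  have "\<exists>x\<in>H. sqnorm lip (\<Phi> x - f) < inverse (real (Suc N))" for N
  proof -
    obtain F where F: "finite F" "F \<subseteq> idx l"
      "sqnorm lip ((\<lambda>k. if k \<in> F then f k else 0) - f) < inverse (real (Suc N))"
      using W.finite_support_approximation[OF f, of "inverse (real (Suc N))"] by auto
    have "(\<lambda>k. if k \<in> F then f k else 0) \<in> \<Phi> ` H"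
      using W.finite_support_in_csubspace[OF csubspace_range _ F(1,2), of f] basis_tensor_in_range
        W.l2tensor_in[OF f] by blast
    then show ?thesis using F(3) by auto
  qed
  then obtain x where x: "\<And>N. x N \<in> H" "\<And>N. sqnorm lip (\<Phi> (x N) - f) < inverse (real (Suc N))"
    by metis
  have \<Phi>x: "\<Phi> (x N) \<in> L" for N using \<Phi>_in x by blast
  have lim: "(\<lambda>N. sqnorm lip (\<Phi> (x N) - f)) \<longlonglongrightarrow> 0"
  proof (rule real_tendsto_sandwich[OF _ _ tendsto_const LIMSEQ_inverse_real_of_nat])
    show "\<forall>\<^sub>F N in sequentially. 0 \<le> sqnorm lip (\<Phi> (x N) - f)"
      by (intro always_eventually allI L.sqnorm_nonneg L.diff_in \<Phi>x f)
    show "\<forall>\<^sub>F N in sequentially. sqnorm lip (\<Phi> (x N) - f) \<le> inverse (real (Suc N))"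
      using x(2) less_imp_le by (intro always_eventually allI) blast
  qed
  have diff: "sqnorm lip (\<Phi> u - \<Phi> v) = sqnorm ip (u - v)" if "u \<in> H" "v \<in> H" for u v
  proof -
    have "\<Phi> (u + (- 1) *\<^sub>C v) = \<Phi> u + (- 1) *\<^sub>C \<Phi> v"
      using \<Phi>_linear that by (simp add: clinear_on_def)
    then have "\<Phi> (u - v) = \<Phi> u - \<Phi> v" by (simp add: scaleC_minus_one)
    then show ?thesis using \<Phi>_sqnorm[of "u - v"] that by simp
  qed
  \<comment> \<open>Convergence in \<open>L\<close> makes the images Cauchy; since
    \<open>\<Phi>\<close> preserves distances, the preimages are Cauchy in \<open>H\<close>, where a
    limit exists.\<close>
  have "L.cauchy_seq (\<lambda>N. \<Phi> (x N))" by (rule L.convergent_cauchy[OF \<Phi>x f lim])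
  then have "cauchy_seq x" by (simp add: cauchy_seq_def L.cauchy_seq_def diff x)
  then obtain y where y: "y \<in> H" "(\<lambda>N. sqnorm ip (x N - y)) \<longlonglongrightarrow> 0"
    using complete[of x] x(1) by blast
  have "(\<lambda>N. sqnorm lip (\<Phi> (x N) - \<Phi> y)) \<longlonglongrightarrow> 0"
    using y x by (simp add: diff)
  then have "f = \<Phi> y"
    by (intro L.limit_unique[OF \<Phi>x f _ lim] \<Phi>_in y)
  then show "f \<in> \<Phi> ` H" using y by blast
qed (use \<Phi>_in in blast)

theorem wold_decomposition:
  "unitarily_equivalent n H ip V (l2tensor l (wandering n H ip V {1..l}) ip) (l2ip l ip) (std_op z l V)"
  unfolding unitarily_equivalent_def wandering_eq_W
proof (intro exI conjI ballI)
  show "\<Phi> ` H = L" by (rule \<Phi>_surj)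
  show "clinear_on H \<Phi>" by (rule \<Phi>_linear)
  have "inner_space L lip" by (rule inner_space.inner_space_l2tensor[OF inner_space_W])
  then show "lip (\<Phi> x) (\<Phi> y) = ip x y" if "x \<in> H" "y \<in> H" for x y
    using polarization[OF inner_space_axioms, of L lip \<Phi> x y] \<Phi>_surj \<Phi>_linear \<Phi>_sqnorm that by blast
qed (rule \<Phi>_V)

end

section \<open>The standard tuple\<close>

lemma prod_ops_id: "i \<notin> set js \<Longrightarrow> prod_ops V js ((\<lambda>_. 0)(i := N)) = id"
  by (induction js) auto

text \<open>Exponents supported at one index isolate the powers of a single operator among the
  conditions defining \<open>wandering\<close>.\<close>

lemma prod_ops_single:
  "\<lbrakk>distinct js; i \<in> set js\<rbrakk> \<Longrightarrow> prod_ops V js ((\<lambda>_. 0)(i := N)) = V i ^^ N"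
  by (induction js) (auto simp: prod_ops_id)

text \<open>A shifted family vanishes where \<open>k i\<close> is 0; this reindexing turns sums over
  the remaining indices into sums over all of \<open>idx l\<close>.\<close>

lemma shift_bij_betw:
  assumes "i \<in> {1..l}"
  shows "bij_betw (\<lambda>k. k(i := Suc (k i))) (idx l) {k \<in> idx l. 1 \<le> k i}"
proof (rule bij_betw_byWitness[where f' = "\<lambda>k. k(i := k i - 1)"])
  show "(\<lambda>k. k(i := Suc (k i))) ` idx l \<subseteq> {k \<in> idx l. 1 \<le> k i}"
    "(\<lambda>k. k(i := k i - 1)) ` {k \<in> idx l. 1 \<le> k i} \<subseteq> idx l"
    using idx_fun_upd[OF _ assms] by auto
qed auto

section \<open>The standard operators and their adjoints\<close>

locale std_tuple = hilbert +
  fixes n l :: nat and z :: "nat \<Rightarrow> nat \<Rightarrow> complex" and U :: "nat \<Rightarrow> 'a \<Rightarrow> 'a"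
  assumes l_le: "l \<le> n"
    and z_unimodular: "\<lbrakk>i \<in> {1..n}; j \<in> {1..n}; i \<noteq> j\<rbrakk> \<Longrightarrow> cmod (z i j) = 1"
    and z_commute: "\<lbrakk>i \<in> {1..n}; j \<in> {1..n}; i \<noteq> j\<rbrakk> \<Longrightarrow> z j i = cnj (z i j)"
    and unitary: "i \<in> {l+1..n} \<Longrightarrow> unitary_on H ip (U i)"
    and U_dnc: "\<lbrakk>i \<in> {l+1..n}; j \<in> {l+1..n}; i \<noteq> j; x \<in> H\<rbrakk> \<Longrightarrow>
      adj H ip (U i) (U j x) = cnj (z i j) *\<^sub>C U j (adj H ip (U i) x)"
begin

abbreviation "L \<equiv> l2tensor l H ip"
abbreviation "lip \<equiv> l2ip l ip"
abbreviation "V \<equiv> std_op z l U"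
abbreviation "Ua i \<equiv> adj H ip (U i)"

text \<open>One formula for both kinds of operators: the product runs over \<open>{1..<i}\<close>
  when \<open>i \<le> l\<close> and over \<open>{1..l}\<close> when \<open>i > l\<close>.\<close>

definition phase :: "nat \<Rightarrow> (nat \<Rightarrow> nat) \<Rightarrow> complex" where
  "phase i k = (\<Prod>j\<in>{j\<in>{1..l}. j < i}. z i j ^ k j)"

text \<open>For a shift the conjugate phase may be taken at \<open>k\<close> rather than at the
  raised index, because \<open>phase i\<close> does not depend on coordinate
  \<open>i\<close>.\<close>

definition std_adj :: "nat \<Rightarrow> ((nat \<Rightarrow> nat) \<Rightarrow> 'a) \<Rightarrow> (nat \<Rightarrow> nat) \<Rightarrow> 'a" where
  "std_adj i f = (\<lambda>k. if k \<in> idx l then cnj (phase i k) *\<^sub>C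
     (if i \<le> l then f (k(i := Suc (k i))) else Ua i (f k)) else 0)"

sublocale L: inner_space L lip
  by (rule inner_space_l2tensor)

lemma std_op_shift:
  assumes "i \<in> {1..l}"
  shows "V i f k = (if k \<in> idx l \<and> 1 \<le> k i then phase i k *\<^sub>C f (k(i := k i - 1)) else 0)"
proof -
  have "{j\<in>{1..l}. j < i} = {1..<i}" using assms by auto
  then show ?thesis using assms by (simp add: std_op_def phase_def)
qed

lemma std_op_diag:
  assumes "l < i"
  shows "V i f k = (if k \<in> idx l then phase i k *\<^sub>C U i (f k) else 0)"
proof -
  have "{j\<in>{1..l}. j < i} = {1..l}" using assms by auto
  then show ?thesis using assms by (simp add: std_op_def phase_def)
qed

lemma phase_unimodular: "i \<in> {1..n} \<Longrightarrow> cmod (phase i k) = 1"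
  using z_unimodular[of i] l_le by (auto simp: phase_def prod_norm[symmetric] norm_power intro!: prod.neutral)

lemma phase_mult_cnj:
  assumes "i \<in> {1..n}"
  shows "phase i k * cnj (phase i k) = 1"
  using phase_unimodular[OF assms, of k] complex_norm_square[of "phase i k"] by simp

lemma phase_nonzero: "i \<in> {1..n} \<Longrightarrow> phase i k \<noteq> 0"
  using phase_unimodular[of i k] by auto

lemma phase_zero [simp]: "phase i (\<lambda>_. 0) = 1"
  by (simp add: phase_def)

text \<open>The source of every commutation factor: raising coordinate \<open>m\<close> is felt by
  \<open>phase i\<close> only if \<open>m < i\<close>.\<close>

lemma phase_Suc:
  assumes "m \<in> {1..l}"
  shows "phase i (k(m := Suc (k m))) = (if m < i then z i m else 1) * phase i k"
proof (cases "m < i")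
  case True
  let ?J = "{j\<in>{1..l}. j < i}"
  have m: "m \<in> ?J" using True assms by auto
  have "phase i k' = z i m ^ k' m * (\<Prod>j\<in>?J - {m}. z i j ^ k' j)" for k'
    unfolding phase_def by (rule prod.remove[OF _ m]) simp
  moreover have "(\<Prod>j\<in>?J - {m}. z i j ^ (k(m := Suc (k m))) j) = (\<Prod>j\<in>?J - {m}. z i j ^ k j)"
    by (rule prod.cong) auto
  ultimately show ?thesis using True by simp
next
  case False
  have "phase i (k(m := Suc (k m))) = phase i k"
    unfolding phase_def by (rule prod.cong) (use False in auto)
  then show ?thesis using False by simp
qed

lemma isom_U: "i \<in> {l+1..n} \<Longrightarrow> isometry H ip (U i)"
  using unitary unfolding unitary_on_def
  by (intro isometry.intro isometry_axioms.intro hilbert_axioms) blast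

lemmas U_in [simp] = isometry.V_in[OF isom_U]
  and U_add = isometry.V_add[OF isom_U]
  and U_scale = isometry.V_scale[OF isom_U]
  and U_zero = isometry.V_zero[OF isom_U]
  and U_sqnorm = isometry.V_sqnorm[OF isom_U]
  and Ua_in [simp] = isometry.V_adj_in[OF isom_U]
  and Ua_U = isometry.V_adj_V[OF isom_U]
  and Ua_scale = isometry.V_adj_scale[OF isom_U]

lemma U_surj: "i \<in> {l+1..n} \<Longrightarrow> U i ` H = H"
  using unitary unfolding unitary_on_def by blast

lemma U_Ua:
  assumes "i \<in> {l+1..n}" "x \<in> H"
  shows "U i (Ua i x) = x"
proof -
  obtain y where "y \<in> H" "x = U i y" using U_surj[OF assms(1)] assms(2) by blast
  then show ?thesis using Ua_U[OF assms(1)] by simp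
qed

lemma Ua_zero: "i \<in> {l+1..n} \<Longrightarrow> Ua i 0 = 0"
  using Ua_scale[of i 0 0] by simp

lemma Ua_sqnorm:
  assumes "i \<in> {l+1..n}" "x \<in> H"
  shows "sqnorm ip (Ua i x) = sqnorm ip x"
  using U_sqnorm[OF assms(1), of "Ua i x"] U_Ua[OF assms] assms by simp

lemma index_cases:
  assumes "i \<in> {1..n}"
  obtains (shift) "i \<in> {1..l}" | (diag) "i \<in> {l+1..n}" "l < i"
  using assms by force

lemma summable_shift_iff:
  assumes "i \<in> {1..l}"
  shows "(\<lambda>k. g (k(i := Suc (k i)))) summable_on idx l \<longleftrightarrow> g summable_on {k \<in> idx l. 1 \<le> k i}"
  by (rule summable_on_reindex_bij_betw[OF shift_bij_betw[OF assms]])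

lemma std_op_in:
  assumes i: "i \<in> {1..n}" and f: "f \<in> L"
  shows "V i f \<in> L"
  using i
proof (cases rule: index_cases)
  case shift
  have "(\<lambda>k. sqnorm ip (V i f (k(i := Suc (k i))))) summable_on idx l \<longleftrightarrow>
      (\<lambda>k. sqnorm ip (f k)) summable_on idx l"
    by (rule summable_on_cong)
      (use i shift idx_fun_upd l2tensor_in[OF f] in
        \<open>simp add: std_op_shift sqnorm_scale phase_unimodular\<close>)
  then have "(\<lambda>k. sqnorm ip (V i f k)) summable_on {k \<in> idx l. 1 \<le> k i}"
    using l2tensor_summable[OF f] summable_shift_iff[OF shift, of "\<lambda>k. sqnorm ip (V i f k)"] by blast
  then have "(\<lambda>k. sqnorm ip (V i f k)) summable_on idx l"
    by (rule summable_on_cong_neutral[THEN iffD1, rotated 3]) (use shift in \<open>auto simp: std_op_shift\<close>)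
  then show ?thesis
    using l2tensor_in[OF f] by (simp add: mem_l2tensor_iff std_op_shift[OF shift])
next
  case diag
  show ?thesis
    by (rule l2tensorI_bound[OF _ _ l2tensor_summable[OF f]])
      (use i diag l2tensor_in[OF f] in
        \<open>simp_all add: std_op_diag sqnorm_scale phase_unimodular U_sqnorm\<close>)
qed

lemma std_adj_in:
  assumes i: "i \<in> {1..n}" and f: "f \<in> L"
  shows "std_adj i f \<in> L"
  using i
proof (cases rule: index_cases)
  case shift
  have "(\<lambda>k. sqnorm ip (f k)) summable_on {k \<in> idx l. 1 \<le> k i}"
    by (rule summable_on_subset_banach[OF l2tensor_summable[OF f]]) auto
  then have sum: "(\<lambda>k. sqnorm ip (f (k(i := Suc (k i))))) summable_on idx l"
    using summable_shift_iff[OF shift, of "\<lambda>k. sqnorm ip (f k)"] by blast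
  show ?thesis
    by (rule l2tensorI_bound[OF _ _ sum])
      (use i shift l2tensor_in[OF f] in \<open>simp_all add: std_adj_def sqnorm_scale phase_unimodular\<close>)
next
  case diag
  show ?thesis
    by (rule l2tensorI_bound[OF _ _ l2tensor_summable[OF f]])
      (use i diag l2tensor_in[OF f] in
        \<open>simp_all add: std_adj_def sqnorm_scale phase_unimodular Ua_sqnorm\<close>)
qed

lemma std_adj_ip:
  assumes i: "i \<in> {1..n}" and f: "f \<in> L" and g: "g \<in> L"
  shows "lip (V i f) g = lip f (std_adj i g)"
  using i
proof (cases rule: index_cases)
  case shift
  have "lip (V i f) g = (\<Sum>\<^sub>\<infinity>k\<in>{k \<in> idx l. 1 \<le> k i}. ip (V i f k) (g k))"
    unfolding l2ip_def
    by (rule infsum_cong_neutral) (use shift l2tensor_in[OF g] in \<open>auto simp: std_op_shift\<close>)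
  also have "\<dots> = (\<Sum>\<^sub>\<infinity>k\<in>idx l. ip (V i f (k(i := Suc (k i)))) (g (k(i := Suc (k i)))))"
    by (rule infsum_reindex_bij_betw[OF shift_bij_betw[OF shift], symmetric])
  also have "\<dots> = lip f (std_adj i g)"
    unfolding l2ip_def
    by (rule infsum_cong)
      (use shift idx_fun_upd l2tensor_in[OF f] l2tensor_in[OF g] in
        \<open>simp add: std_op_shift std_adj_def ip_linear phase_Suc\<close>)
  finally show ?thesis .
next
  case diag
  have "ip (V i f k) (g k) = ip (f k) (std_adj i g k)" if "k \<in> idx l" for k
    using that diag l2tensor_in[OF f] l2tensor_in[OF g]
    by (simp add: std_op_diag std_adj_def ip_linear isometry.ip_V_adj[OF isom_U])
  then show ?thesis unfolding l2ip_def by (rule infsum_cong)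
qed

lemma adj_std_op: "i \<in> {1..n} \<Longrightarrow> f \<in> L \<Longrightarrow> adj L lip (V i) f = std_adj i f"
  by (rule L.adj_eqI) (simp_all add: std_adj_in std_adj_ip)

lemma std_adj_std_op:
  assumes i: "i \<in> {1..n}" and f: "f \<in> L"
  shows "std_adj i (V i f) = f"
proof
  fix k
  have mult: "cnj (phase i k) * phase i k = 1"
    using phase_mult_cnj[OF i, of k] by (simp add: mult.commute)
  show "std_adj i (V i f) k = f k"
    using i
  proof (cases rule: index_cases)
    case shift
    then show ?thesis
      using idx_fun_upd l2tensor_outside[OF f] mult
      by (simp add: std_adj_def std_op_shift phase_Suc scaleC_scaleC scaleC_one)
  next
    case diag
    then show ?thesis
      using l2tensor_outside[OF f] l2tensor_in[OF f] mult
      by (simp add: std_adj_def std_op_diag Ua_scale Ua_U scaleC_scaleC scaleC_one)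
  qed
qed

lemma std_op_std_adj:
  assumes i: "i \<in> {l+1..n}" and f: "f \<in> L"
  shows "V i (std_adj i f) = f"
proof
  fix k
  have "i \<in> {1..n}" "l < i" using i by auto
  then show "V i (std_adj i f) k = f k"
    using l2tensor_outside[OF f] l2tensor_in[OF f] phase_mult_cnj[of i k] i
    by (simp add: std_adj_def std_op_diag U_scale U_Ua scaleC_scaleC scaleC_one)
qed

lemma std_op_linear:
  assumes "i \<in> {1..n}"
  shows "clinear_on L (V i)"
  using assms
proof (cases rule: index_cases)
  case shift
  then show ?thesis
    by (auto simp: clinear_on_def fun_eq_iff std_op_shift scaleC_add_right scaleC_scaleC mult.commute)
next
  case diag
  then show ?thesis
    using l2tensor_in
    by (auto simp: clinear_on_def fun_eq_iff std_op_diag U_add U_scale scaleC_add_right scaleC_scaleC mult.commute)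
qed

text \<open>Inner products are preserved because the explicit adjoint is a left inverse.\<close>

lemma std_op_isometry:
  assumes i: "i \<in> {1..n}"
  shows "isometry_on L lip (V i)"
  unfolding isometry_on_def
  using std_op_linear[OF i] std_op_in[OF i] std_adj_ip[OF i] std_adj_std_op[OF i] by auto

text \<open>Unless both operators are diagonal, exactly one of the two phases changes:
  \<open>phase i\<close> if \<open>j < i\<close>, contributing \<open>cnj (z i j)\<close>, and
  \<open>phase j\<close> if \<open>i < j\<close>, contributing \<open>z j i\<close>, which is the
  same number. For two diagonal operators the factor comes from the relation between the
  \<open>U i\<close>.\<close>

lemma std_adj_commute:
  assumes i: "i \<in> {1..n}" and j: "j \<in> {1..n}" and ij: "i \<noteq> j" and f: "f \<in> L"
  shows "std_adj i (V j f) = cnj (z i j) *\<^sub>C V j (std_adj i f)"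
proof
  fix k
  note zc = z_commute[OF i j ij]
  show "std_adj i (V j f) k = (cnj (z i j) *\<^sub>C V j (std_adj i f)) k"
  proof (cases "k \<in> idx l")
    case False
    from j show ?thesis
      by (cases rule: index_cases) (use False in \<open>simp_all add: std_adj_def std_op_shift std_op_diag\<close>)
  next
    case k: True
    show ?thesis
      using j
    proof (cases rule: index_cases)
      case js: shift
      show ?thesis
      proof (cases "k j = 0")
        case True
        \<comment> \<open>Both sides vanish here: the adjoint at \<open>i\<close>, with
          \<open>i \<noteq> j\<close>, leaves coordinate \<open>j\<close> at 0, where the shift
          \<open>V j\<close> has no component.\<close>
        from i show ?thesis
          by (cases rule: index_cases)
            (use True k js ij in \<open>simp_all add: std_adj_def std_op_shift Ua_zero\<close>)
      next
        case False
        \<comment> \<open>Writing \<open>k\<close> as \<open>k'\<close> raised at \<open>j\<close>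
          brings the downward step of \<open>V j\<close> into the form that \<open>phase_Suc\<close>
          handles.\<close>
        define k' where "k' = k(j := k j - 1)"
        have kd: "k(j := k j - Suc 0) = k'" by (simp add: k'_def)
        have kk: "k = k'(j := Suc (k' j))" using False by (auto simp: k'_def)
        have k': "k' \<in> idx l" using k js by (simp add: k'_def idx_fun_upd)
        have phase_k: "phase i k = (if j < i then z i j else 1) * phase i k'"
          by (subst kk) (rule phase_Suc[OF js])
        show ?thesis
          using i
        proof (cases rule: index_cases)
          case shift
          have "k(i := Suc (k i), j := k j - Suc 0) = k'(i := Suc (k i))" "k' i = k i"
            using ij by (auto simp: k'_def)
          then show ?thesis
            using shift js ij k k' False phase_k zc idx_fun_upd[OF k shift] phase_Suc[OF shift, of j k]
            by (auto simp: std_adj_def std_op_shift kd scaleC_scaleC mult_ac)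
        next
          case diag
          have "j < i" using diag js by auto
          then show ?thesis
            using diag js k k' False phase_k l2tensor_in[OF f]
            by (auto simp: std_adj_def std_op_shift kd Ua_scale scaleC_scaleC mult_ac)
        qed
      qed
    next
      case jd: diag
      show ?thesis
        using i
      proof (cases rule: index_cases)
        case shift
        have "i < j" using jd shift by auto
        then show ?thesis
          using shift jd k zc idx_fun_upd[OF k shift] phase_Suc[OF shift, of j k] l2tensor_in[OF f]
          by (simp add: std_adj_def std_op_diag U_scale scaleC_scaleC mult_ac)
      next
        case diag
        then show ?thesis
          using jd k ij U_dnc l2tensor_in[OF f]
          by (simp add: std_adj_def std_op_diag U_scale Ua_scale scaleC_scaleC mult_ac)
      qed
    qed
  qed
qed

lemma dnc_std: "dnc n z L lip V"
  unfolding dnc_def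
  using std_op_isometry std_op_in std_adj_commute by (simp add: adj_std_op)

lemma std_op_unitary:
  assumes "i \<in> {l+1..n}"
  shows "unitary_on L lip (V i)"
proof -
  have i: "i \<in> {1..n}" using assms by auto
  have "f \<in> V i ` L" if "f \<in> L" for f
    using std_op_std_adj[OF assms that] std_adj_in[OF i that] by (metis imageI)
  then show ?thesis
    unfolding unitary_on_def using std_op_isometry[OF i] std_op_in[OF i] by blast
qed

text \<open>Each application raises coordinate \<open>i\<close> by one, so the \<open>N\<close>-fold
  image has no component with \<open>k i < N\<close>.\<close>

lemma std_op_pow_vanishes: "i \<in> {1..l} \<Longrightarrow> k i < N \<Longrightarrow> (V i ^^ N) f k = 0"
proof (induction N arbitrary: k)
  case (Suc N)
  show ?case
  proof (cases "1 \<le> k i")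
    case True
    then have "(V i ^^ N) f (k(i := k i - 1)) = 0"
      using Suc.prems by (intro Suc.IH) auto
    then show ?thesis
      using std_op_shift[OF Suc.prems(1), of "(V i ^^ N) f" k] by (simp del: fun_upd_apply)
  qed (use Suc.prems in \<open>simp add: std_op_shift\<close>)
qed simp

lemma range_Inter_std_op:
  assumes "i \<in> {1..l}" "\<And>N. f \<in> range (V i ^^ N)"
  shows "f = 0"
proof
  fix k
  obtain g where "f = (V i ^^ Suc (k i)) g" using assms(2)[of "Suc (k i)"] by blast
  then show "f k = 0 k" using std_op_pow_vanishes[OF assms(1), of k "Suc (k i)" g] by simp
qed

lemma std_op_pure:
  assumes i: "i \<in> {1..l}"
  shows "pure_isometry L lip (V i)"
  unfolding pure_isometry_def
proof (intro conjI allI impI)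
  show "isometry_on L lip (V i)" using i l_le by (intro std_op_isometry) auto
  fix M assume M: "closed_csubspace L lip M" and u: "unitary_on M lip (V i)"
  have "V i ` M = M" using u by (simp add: unitary_on_def)
  \<comment> \<open>A subspace on which \<open>V i\<close> is onto lies in the range of every power,
    where only 0 survives.\<close>
  then have pow: "(V i ^^ N) ` M = M" for N
  proof (induction N)
    case (Suc N)
    have "(V i ^^ Suc N) ` M = V i ` (V i ^^ N) ` M" by (simp add: image_image)
    then show ?case using Suc by simp
  qed simp
  have "f = 0" if "f \<in> M" for f
    using that pow by (intro range_Inter_std_op[OF i]) blast
  moreover have "0 \<in> M" using M by (simp add: closed_csubspace_def csubspace_def)
  ultimately show "M = {0}" by blast
qed

section \<open>Wandering subspaces of the standard tuple\<close>

abbreviation "e0 \<equiv> basis_tensor (\<lambda>_::nat. 0::nat)"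

lemma e0_in: "x \<in> H \<Longrightarrow> e0 x \<in> L"
  by (rule basis_tensor_in_l2) simp_all

lemma std_op_e0:
  assumes "j \<in> {l+1..n}"
  shows "V j (e0 x) = e0 (U j x)"
  using assms U_zero[OF assms] by (auto simp: fun_eq_iff[where 'b = 'a] std_op_diag basis_tensor_apply scaleC_one)

lemma joint_kernel: "{f \<in> L. \<forall>i\<in>{1..l}. adj L lip (V i) f = 0} = e0 ` H"
proof (intro equalityI subsetI)
  fix f assume "f \<in> {f \<in> L. \<forall>i\<in>{1..l}. adj L lip (V i) f = 0}"
  then have f: "f \<in> L" and ker: "\<And>i. i \<in> {1..l} \<Longrightarrow> std_adj i f = 0"
    using adj_std_op l_le by auto
  have "f k = 0" if "k \<noteq> (\<lambda>_. 0)" for k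
  proof (cases "k \<in> idx l")
    case True
    then obtain i where i: "i \<in> {1..l}" "k i \<noteq> 0"
      using \<open>k \<noteq> (\<lambda>_. 0)\<close> unfolding idx_def by blast
    let ?k = "k(i := k i - 1)"
    have "k = ?k(i := Suc (?k i))" using i by auto
    moreover have "?k \<in> idx l" using True i(1) by (rule idx_fun_upd)
    \<comment> \<open>Every nonzero index is some \<open>?k\<close> raised at an \<open>i\<close>,
      so the component of \<open>f\<close> there shows up, times a unimodular factor, in the
      vanishing family \<open>std_adj i f\<close>.\<close>
    ultimately have "cnj (phase i ?k) *\<^sub>C f k = std_adj i f ?k"
      using i by (simp add: std_adj_def del: fun_upd_apply)
    also have "\<dots> = cnj (phase i ?k) *\<^sub>C 0" by (simp add: ker[OF i(1)])
    finally have "cnj (phase i ?k) *\<^sub>C f k = cnj (phase i ?k) *\<^sub>C 0" .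
    moreover have "cnj (phase i ?k) \<noteq> 0" using i l_le phase_nonzero[of i ?k] by auto
    ultimately show ?thesis using scaleC_cancel by blast
  qed (rule l2tensor_outside[OF f])
  then have "f = e0 (f (\<lambda>_. 0))" by (intro ext) (auto simp: basis_tensor_apply)
  then show "f \<in> e0 ` H" using l2tensor_in[OF f] by blast
next
  fix f assume "f \<in> e0 ` H"
  then obtain x where x: "x \<in> H" "f = e0 x" by blast
  have "std_adj i f = 0" if "i \<in> {1..l}" for i
  proof
    fix k :: "nat \<Rightarrow> nat"
    have "k(i := Suc (k i)) \<noteq> (\<lambda>_. 0)" by (metis fun_upd_same nat.simps(3))
    then show "std_adj i f k = 0 k" using that x by (simp add: std_adj_def basis_tensor_apply)
  qed
  then show "f \<in> {f \<in> L. \<forall>i\<in>{1..l}. adj L lip (V i) f = 0}"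
    using x e0_in adj_std_op l_le by auto
qed

lemma wandering_std: "wandering n L lip V {1..l} = e0 ` H"
proof -
  have "V j ` e0 ` H = e0 ` H" if "j \<in> {1..n} - {1..l}" for j
  proof -
    have j: "j \<in> {l+1..n}" using that by auto
    have "V j ` e0 ` H = e0 ` U j ` H" by (simp add: image_image std_op_e0[OF j])
    then show ?thesis by (simp add: U_surj[OF j])
  qed
  then show ?thesis
    using wandering_eq[of n "{1..l}" V L lip] by (simp only: joint_kernel)
qed

text \<open>The canonical identification of \<open>H\<close> with the wandering subspace. Operators
  are renumbered by \<open>l + i\<close> since \<open>unitarily_equivalent\<close> indexes tuples
  from 1.\<close>

lemma e0_equivalence:
  "unitarily_equivalent (n - l) H ip (\<lambda>i. U (l + i)) (e0 ` H) lip (\<lambda>i. V (l + i))"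
  unfolding unitarily_equivalent_def
proof (intro exI conjI ballI)
  show "e0 ` H = e0 ` H" ..
  show "clinear_on H e0" by (auto simp: clinear_on_def fun_eq_iff basis_tensor_apply)
  show "lip (e0 x) (e0 y) = ip x y" if "x \<in> H" "y \<in> H" for x y
    using that by (intro l2ip_basis_tensor) simp_all
  show "e0 (U (l + i) x) = V (l + i) (e0 x)" if "i \<in> {1..n - l}" for i x
    using that l_le by (intro std_op_e0[symmetric]) auto
qed

lemma std_op_zero: "i \<in> {1..n} \<Longrightarrow> V i 0 = 0"
  using L.isometry_zero[OF std_op_isometry] .

text \<open>Since \<open>A\<close> differs from \<open>{1..l}\<close>, either it misses some shift
  index, and then a wandering vector lies in the range of all powers of that shift, or it contains
  the index of a unitary, whose adjoint has trivial kernel.\<close>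

lemma wandering_std_other:
  assumes A: "A \<subseteq> {1..n}" "A \<noteq> {1..l}"
  shows "wandering n L lip V A = {0}"
proof -
  let ?K = "{f \<in> L. \<forall>i\<in>A. adj L lip (V i) f = 0}"
  let ?js = "sorted_list_of_set ({1..n} - A)"
  have zero: "prod_ops V ?js m ` {0} = {0}" for m
    by (rule prod_ops_image) (auto simp: std_op_zero)
  have "0 \<in> ?K"
    using A(1) by (auto simp: L.zero_in adj_std_op std_adj_def fun_eq_iff Ua_zero)
  then have "0 \<in> wandering n L lip V A"
    unfolding wandering_def Let_def using zero by blast
  moreover have "f = 0" if "f \<in> wandering n L lip V A" for f
  proof (cases "A \<subseteq> {1..l}")
    case True
    then obtain i where i: "i \<in> {1..l}" "i \<notin> A" using A(2) by blast
    have "i \<in> set ?js" using i l_le by auto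
    then have "f \<in> (V i ^^ N) ` ?K" for N
      using \<open>f \<in> _\<close> prod_ops_single[of ?js i V N] unfolding wandering_def Let_def
      by (auto dest: spec[of _ "(\<lambda>_. 0)(i := N)"])
    then show ?thesis by (intro range_Inter_std_op[OF i(1)]) blast
  next
    case False
    then obtain i where i: "i \<in> A" "i \<in> {l+1..n}" "i \<in> {1..n}" using A(1) by fastforce
    have "g = 0" if "g \<in> ?K" for g
      using that i std_op_std_adj[OF i(2), of g] std_op_zero[OF i(3)] adj_std_op[OF i(3), of g] by auto
    then have K: "?K = {0}" using \<open>0 \<in> ?K\<close> by blast
    have "f \<in> prod_ops V ?js (\<lambda>_. 0) ` ?K"
      using \<open>f \<in> _\<close> unfolding wandering_def Let_def by blast
    then show ?thesis unfolding K using zero by blast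
  qed
  ultimately show ?thesis by blast
qed

end

theorem theorem4p5:
  fixes n l :: nat and z :: "nat \<Rightarrow> nat \<Rightarrow> complex"
  assumes "l \<le> n"
    and "\<forall>i\<in>{1..n}. \<forall>j\<in>{1..n}. i \<noteq> j \<longrightarrow> cmod (z i j) = 1 \<and> z j i = cnj (z i j)"
  shows
   "(\<forall>(W :: 'w::complex_vector set) ipW Ut.
      hilbert_space W ipW \<and>
      (\<forall>i\<in>{l+1..n}. unitary_on W ipW (Ut i)) \<and>
      (\<forall>i\<in>{l+1..n}. \<forall>j\<in>{l+1..n}. i \<noteq> j \<longrightarrow>
          (\<forall>x\<in>W. adj W ipW (Ut i) (Ut j x) = cnj (z i j) *\<^sub>C Ut j (adj W ipW (Ut i) x)))
      \<longrightarrow>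
      (let L = l2tensor l W ipW; ip = l2ip l ipW; V = std_op z l Ut
       in dnc n z L ip V \<and>
          wandering n L ip V {1..l} = basis_tensor (\<lambda>_. 0) ` W \<and>
          unitarily_equivalent (n - l) W ipW (\<lambda>i. Ut (l + i))
              (wandering n L ip V {1..l}) ip (\<lambda>i. V (l + i)) \<and>
          (\<forall>j\<in>{l+1..n}. \<forall>x\<in>W. V j (basis_tensor (\<lambda>_. 0) x) = basis_tensor (\<lambda>_. 0) (Ut j x)) \<and>
          (\<forall>A. A \<subseteq> {1..n} \<longrightarrow> A \<noteq> {1..l} \<longrightarrow> wandering n L ip V A = {0}) \<and>
          (\<forall>i\<in>{1..l}. pure_isometry L ip (V i)) \<and>
          (\<forall>i\<in>{l+1..n}. unitary_on L ip (V i))))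
    \<and>
    (\<forall>(H :: 'h::complex_vector set) ip V.
      hilbert_space H ip \<and> dnc n z H ip V \<and>
      (\<forall>i\<in>{1..l}. pure_isometry H ip (V i)) \<and>
      (\<forall>i\<in>{l+1..n}. unitary_on H ip (V i))
      \<longrightarrow>
      (let W = wandering n H ip V {1..l}
       in unitarily_equivalent n H ip V (l2tensor l W ip) (l2ip l ip) (std_op z l V)))"
proof (intro conjI allI impI)
  fix W :: "'w set" and ipW Ut
  assume h: "hilbert_space W ipW \<and>
      (\<forall>i\<in>{l+1..n}. unitary_on W ipW (Ut i)) \<and>
      (\<forall>i\<in>{l+1..n}. \<forall>j\<in>{l+1..n}. i \<noteq> j \<longrightarrow>
          (\<forall>x\<in>W. adj W ipW (Ut i) (Ut j x) = cnj (z i j) *\<^sub>C Ut j (adj W ipW (Ut i) x)))"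
  then have "hilbert_space W ipW" by (rule conjunct1)
  then interpret hilbert W ipW by (rule hilbertI)
  interpret std_tuple W ipW n l z Ut
    by unfold_locales (use assms h in blast)+
  show "let L = l2tensor l W ipW; ip = l2ip l ipW; V = std_op z l Ut
       in dnc n z L ip V \<and>
          wandering n L ip V {1..l} = basis_tensor (\<lambda>_. 0) ` W \<and>
          unitarily_equivalent (n - l) W ipW (\<lambda>i. Ut (l + i))
              (wandering n L ip V {1..l}) ip (\<lambda>i. V (l + i)) \<and>
          (\<forall>j\<in>{l+1..n}. \<forall>x\<in>W. V j (basis_tensor (\<lambda>_. 0) x) = basis_tensor (\<lambda>_. 0) (Ut j x)) \<and>
          (\<forall>A. A \<subseteq> {1..n} \<longrightarrow> A \<noteq> {1..l} \<longrightarrow> wandering n L ip V A = {0}) \<and>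
          (\<forall>i\<in>{1..l}. pure_isometry L ip (V i)) \<and>
          (\<forall>i\<in>{l+1..n}. unitary_on L ip (V i))"
    unfolding Let_def wandering_std
    by (intro conjI ballI allI impI dnc_std refl e0_equivalence std_op_e0 wandering_std_other
        std_op_pure std_op_unitary)
next
  fix H :: "'h set" and ip V
  assume h: "hilbert_space H ip \<and> dnc n z H ip V \<and>
      (\<forall>i\<in>{1..l}. pure_isometry H ip (V i)) \<and>
      (\<forall>i\<in>{l+1..n}. unitary_on H ip (V i))"
  then have "hilbert_space H ip" by (rule conjunct1)
  then interpret hilbert H ip by (rule hilbertI)
  interpret wold_tuple H ip n z V l
    by unfold_locales (use assms h in blast)+
  show "let W = wandering n H ip V {1..l}
       in unitarily_equivalent n H ip V (l2tensor l W ip) (l2ip l ip) (std_op z l V)"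
    unfolding Let_def by (rule wold_decomposition)
qed

end
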